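(* Let $G$ be a finitely generated group, $\mathcal{F}$ a family of subgroups of $G$, $n\in\mathbb{N}$, and let $\overline{X}$ be a compact Hausdorff $G$-space. Consider the following conditions: (1) $\mathcal{F}\text{-eq-asdim}\, G\times\overline{X}\le n$; (2) for each $r<\infty$ there exist $(G,r)$-disjoint $\mathcal{F}$-families $\mathcal{I}^i$, $0\le i\le n$, of subsets of $G\times\overline{X}$ such that $\bigcup_i\mathcal{I}^i$ is an open cover of $G\times\overline{X}$; (3) for each $d<\infty$ there exists an open $\mathcal{F}$-cover $\mathcal{I}$ of $G\times\overline{X}$ with $(G,d)$-multiplicity at most $n+1$. Then conditions (1) and (2) are equivalent and imply condition (3). If $\mathcal{F}$ is virtually closed, then all three conditions are equivalent.
   Context: $G$ is discrete and equipped with a fixed word-length metric coming from a finite generating set; $\overline{B}(g,\alpha)$ denotes the closed ball in $G$. $G\times\overline{X}$ carries the diagonal $G$-action $h(g,x)=(hg,hx)$. A family of subgroups of $G$ is a set of subgroups closed under conjugation and under taking subgroups. It is virtually closed if whenever $H\in\mathcal{F}$, $H\le H'\le G$ and $[H':H]<\infty$, also $H'\in\mathcal{F}$. Let $Y$ be a $G$-set. A subset $U\subseteq Y$ is an $\mathcal{F}$-subset if any two elements $gU,g'U$ of its orbit are either equal or disjoint and its stabiliser $\{g\in G : gU=U\}$ belongs to $\mathcal{F}$. An $\mathcal{F}$-family is a $G$-invariant family of $\mathcal{F}$-subsets; an $\mathcal{F}$-cover is an $\mathcal{F}$-family that is a cover. A cover is open if its members are open. For a family $\mathcal{U}$ of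 subsets of $Y$, $\dim\mathcal{U}=\sup_{y\in Y}|\{U\in\mathcal{U} : y\in U\}|-1$. For a cover $\mathcal{U}$ of $G\times\overline{X}$, $\alpha<\infty$ is a $G$-Lebesgue number of $\mathcal{U}$ if for each $(g,x)$ there is $U\in\mathcal{U}$ with $\overline{B}(g,\alpha)\times\{x\}\subseteq U$. $\mathcal{F}\text{-eq-asdim}\, G\times\overline{X}$ is the smallest integer $n$ such that for every $\alpha<\infty$ there is an open $\mathcal{F}$-cover $\mathcal{U}$ of $G\times\overline{X}$ with $\dim\mathcal{U}\le n$ and having $\alpha$ as a $G$-Lebesgue number; it is infinite if no such $n$ exists. For $U\subseteq G\times\overline{X}$ and $r>0$ put $\overline{B}(U,r)=\bigcup_{(g,x)\in U}\overline{B}(g,r)\times\{x\}$. A family of subsets of $G\times\overline{X}$ is $(G,r)$-disjoint if $\overline{B}(U,r)\cap U'=\emptyset$ for any two distinct elements $U\ne U'$ of it. A covering of $G\times\overline{X}$ has $(G,d)$-multiplicity at most $k$ if each set of the form $\overline{B}(g,d)\times\{x\}$ intersects at most $k$ elements of the covering. *)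

theory Defs
  imports "HOL-Analysis.Analysis" "HOL-Algebra.Group_Action" "HOL-Algebra.Generated_Groups"
begin

section \<open>Families of subgroups\<close>

definition subgroup_family :: "('g, 'm) monoid_scheme \<Rightarrow> 'g set set \<Rightarrow> bool" where
  "subgroup_family G F \<longleftrightarrow>
     (\<forall>H\<in>F. subgroup H G) \<and>
     (\<forall>H\<in>F. \<forall>g\<in>carrier G. g <#\<^bsub>G\<^esub> H #>\<^bsub>G\<^esub> inv\<^bsub>G\<^esub> g \<in> F) \<and>
     (\<forall>H\<in>F. \<forall>K. subgroup K G \<and> K \<subseteq> H \<longrightarrow> K \<in> F)"

definition virtually_closed :: "('g, 'm) monoid_scheme \<Rightarrow> 'g set set \<Rightarrow> bool" where
  "virtually_closed G F \<longleftrightarrow>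
     (\<forall>H\<in>F. \<forall>H'. subgroup H' G \<and> H \<subseteq> H' \<and> finite (rcosets\<^bsub>G\<lparr>carrier := H'\<rparr>\<^esub> H) \<longrightarrow> H' \<in> F)"


section \<open>Word metrics\<close>

definition word_length :: "('g, 'm) monoid_scheme \<Rightarrow> 'g set \<Rightarrow> 'g \<Rightarrow> nat" where
  "word_length G S g =
     (LEAST k. \<exists>ws. set ws \<subseteq> S \<union> m_inv G ` S \<and> length ws = k \<and> foldr (mult G) ws \<one>\<^bsub>G\<^esub> = g)"

text \<open>The left-invariant metric, so that the action of \<open>G\<close> on itself by left translations,
  hence also the diagonal action below, is isometric in the \<open>G\<close>-direction.\<close>

definition word_dist :: "('g, 'm) monoid_scheme \<Rightarrow> 'g set \<Rightarrow> 'g \<Rightarrow> 'g \<Rightarrow> real" where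
  "word_dist G S g h = real (word_length G S (inv\<^bsub>G\<^esub> g \<otimes>\<^bsub>G\<^esub> h))"

definition word_cball :: "('g, 'm) monoid_scheme \<Rightarrow> 'g set \<Rightarrow> 'g \<Rightarrow> real \<Rightarrow> 'g set" where
  "word_cball G S g r = {h \<in> carrier G. word_dist G S g h \<le> r}"


section \<open>Actions\<close>

text \<open>As the group is discrete, continuity of the action means that every group element acts
  by a continuous map.\<close>

definition G_space :: "('g, 'm) monoid_scheme \<Rightarrow> 'x topology \<Rightarrow> ('g \<Rightarrow> 'x \<Rightarrow> 'x) \<Rightarrow> bool" where
  "G_space G X \<phi> \<longleftrightarrow>
     group_action G (topspace X) \<phi> \<and> (\<forall>g\<in>carrier G. continuous_map X X (\<phi> g))"

definition prod_space :: "('g, 'm) monoid_scheme \<Rightarrow> 'x topology \<Rightarrow> ('g \<times> 'x) topology" where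
  "prod_space G X = prod_topology (discrete_topology (carrier G)) X"

definition diag_action ::
  "('g, 'm) monoid_scheme \<Rightarrow> 'x topology \<Rightarrow> ('g \<Rightarrow> 'x \<Rightarrow> 'x) \<Rightarrow> 'g \<Rightarrow> 'g \<times> 'x \<Rightarrow> 'g \<times> 'x" where
  "diag_action G X \<phi> h = (\<lambda>(g, x) \<in> carrier G \<times> topspace X. (h \<otimes>\<^bsub>G\<^esub> g, \<phi> h x))"

lemma group_action_diag_action:
  assumes "group_action G (topspace X) \<phi>"
  shows "group_action G (topspace (prod_space G X)) (diag_action G X \<phi>)"
proof -
  interpret A: group_action G "topspace X" \<phi> by fact
  interpret group G using A.group_hom by (simp add: group_hom_def)
  let ?Y = "carrier G \<times> topspace X" and ?D = "diag_action G X \<phi>"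
  have mem: "\<phi> g x \<in> topspace X" if "g \<in> carrier G" "x \<in> topspace X" for g x
    using A.element_image that by blast
  have comp: "?D (g \<otimes>\<^bsub>G\<^esub> h) y = ?D g (?D h y)"
    if "g \<in> carrier G" "h \<in> carrier G" "y \<in> ?Y" for g h y
    using that by (auto simp: diag_action_def m_assoc mem A.composition_rule)
  have one: "?D \<one>\<^bsub>G\<^esub> y = y" if "y \<in> ?Y" for y
    using that by (auto simp: diag_action_def A.id_eq_one[symmetric])
  have clos: "?D g y \<in> ?Y" if "g \<in> carrier G" "y \<in> ?Y" for g y
    using that by (auto simp: diag_action_def mem)
  have bij: "?D g \<in> Bij ?Y" if g: "g \<in> carrier G" for g
  proof -
    have "bij_betw (?D g) ?Y ?Y"
    proof (rule bij_betw_byWitness[where f' = "?D (inv\<^bsub>G\<^esub> g)"])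
      show "\<forall>y\<in>?Y. ?D (inv\<^bsub>G\<^esub> g) (?D g y) = y"
        using g one comp[of "inv\<^bsub>G\<^esub> g" g] by (metis inv_closed l_inv)
      show "\<forall>y\<in>?Y. ?D g (?D (inv\<^bsub>G\<^esub> g) y) = y"
        using g one comp[of g "inv\<^bsub>G\<^esub> g"] by (metis inv_closed r_inv)
    qed (use g clos in blast)+
    then show ?thesis
      by (simp add: Bij_def diag_action_def)
  qed
  have "?D \<in> hom G (BijGroup ?Y)"
  proof (rule homI)
    fix g h assume gh: "g \<in> carrier G" "h \<in> carrier G"
    have "?D (g \<otimes>\<^bsub>G\<^esub> h) = compose ?Y (?D g) (?D h)"
    proof (rule extensionalityI)
      show "?D (g \<otimes>\<^bsub>G\<^esub> h) \<in> extensional ?Y"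
        by (simp add: diag_action_def)
      show "?D (g \<otimes>\<^bsub>G\<^esub> h) y = compose ?Y (?D g) (?D h) y" if "y \<in> ?Y" for y
        using comp[OF gh that] that by (simp add: compose_def)
    qed (rule compose_extensional)
    then show "?D (g \<otimes>\<^bsub>G\<^esub> h) = ?D g \<otimes>\<^bsub>BijGroup ?Y\<^esub> ?D h"
      using gh bij by (simp add: BijGroup_def)
  qed (use bij in \<open>simp add: BijGroup_def\<close>)
  then show ?thesis
    unfolding group_action_def group_hom_def group_hom_axioms_def prod_space_def
    by (simp add: group_BijGroup is_group)
qed


section \<open>Covers by sets with stabilisers in a family of subgroups\<close>

text \<open>Below, \<open>Y\<close> is a set with a \<open>G\<close>-action \<open>\<psi>\<close>, and \<open>F\<close> is a family of subgroups.\<close>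

definition F_subset ::
  "('g, 'm) monoid_scheme \<Rightarrow> 'y set \<Rightarrow> ('g \<Rightarrow> 'y \<Rightarrow> 'y) \<Rightarrow> 'g set set \<Rightarrow> 'y set \<Rightarrow> bool" where
  "F_subset G Y \<psi> F U \<longleftrightarrow>
     U \<subseteq> Y \<and>
     (\<forall>g\<in>carrier G. \<forall>g'\<in>carrier G. \<psi> g ` U = \<psi> g' ` U \<or> disjnt (\<psi> g ` U) (\<psi> g' ` U)) \<and>
     stabilizer G (\<lambda>g V. \<psi> g ` V) U \<in> F"

definition F_fam ::
  "('g, 'm) monoid_scheme \<Rightarrow> 'y set \<Rightarrow> ('g \<Rightarrow> 'y \<Rightarrow> 'y) \<Rightarrow> 'g set set \<Rightarrow> 'y set set \<Rightarrow> bool" where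
  "F_fam G Y \<psi> F \<U> \<longleftrightarrow>
     (\<forall>U\<in>\<U>. F_subset G Y \<psi> F U) \<and> (\<forall>g\<in>carrier G. \<forall>U\<in>\<U>. \<psi> g ` U \<in> \<U>)"

definition open_cover :: "'y topology \<Rightarrow> 'y set set \<Rightarrow> bool" where
  "open_cover T \<U> \<longleftrightarrow> (\<forall>U\<in>\<U>. openin T U) \<and> \<Union>\<U> = topspace T"

definition open_F_cover ::
  "('g, 'm) monoid_scheme \<Rightarrow> 'y topology \<Rightarrow> ('g \<Rightarrow> 'y \<Rightarrow> 'y) \<Rightarrow> 'g set set \<Rightarrow> 'y set set \<Rightarrow> bool" where
  "open_F_cover G T \<psi> F \<U> \<longleftrightarrow> F_fam G (topspace T) \<psi> F \<U> \<and> open_cover T \<U>"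

definition ecard :: "'a set \<Rightarrow> enat" where
  "ecard A = (if finite A then enat (card A) else \<infinity>)"

text \<open>The supremum is formed in \<open>enat\<close>, so that the dimension is \<open>-1\<close> if \<open>Y\<close> is empty.\<close>

definition fam_dim :: "'y set \<Rightarrow> 'y set set \<Rightarrow> ereal" where
  "fam_dim Y \<U> = ereal_of_enat (SUP y\<in>Y. ecard {U\<in>\<U>. y \<in> U}) - 1"


section \<open>Equivariant asymptotic dimension\<close>

definition G_Lebesgue_number ::
  "('g, 'm) monoid_scheme \<Rightarrow> 'g set \<Rightarrow> 'x topology \<Rightarrow> ('g \<times> 'x) set set \<Rightarrow> real \<Rightarrow> bool" where
  "G_Lebesgue_number G S X \<U> \<alpha> \<longleftrightarrow>
     (\<forall>g\<in>carrier G. \<forall>x\<in>topspace X. \<exists>U\<in>\<U>. word_cball G S g \<alpha> \<times> {x} \<subseteq> U)"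

text \<open>The infimum ranges over integers that are at least \<open>-1\<close>, because a dimension is never
  less than \<open>-1\<close>; so it is a minimum, unless there is no such integer and it is \<open>\<infinity>\<close>.\<close>

definition eq_asdim ::
  "('g, 'm) monoid_scheme \<Rightarrow> 'g set \<Rightarrow> 'g set set \<Rightarrow> 'x topology \<Rightarrow> ('g \<Rightarrow> 'x \<Rightarrow> 'x) \<Rightarrow> ereal" where
  "eq_asdim G S F X \<phi> =
     Inf {ereal (of_int n) | n :: int.
            \<forall>\<alpha>\<ge>0. \<exists>\<U>. open_F_cover G (prod_space G X) (diag_action G X \<phi>) F \<U> \<and>
                       fam_dim (topspace (prod_space G X)) \<U> \<le> ereal (of_int n) \<and>
                       G_Lebesgue_number G S X \<U> \<alpha>}"

definition G_nbhd ::
  "('g, 'm) monoid_scheme \<Rightarrow> 'g set \<Rightarrow> ('g \<times> 'x) set \<Rightarrow> real \<Rightarrow> ('g \<times> 'x) set" where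
  "G_nbhd G S U r = (\<Union>(g, x)\<in>U. word_cball G S g r \<times> {x})"

definition G_disjoint ::
  "('g, 'm) monoid_scheme \<Rightarrow> 'g set \<Rightarrow> real \<Rightarrow> ('g \<times> 'x) set set \<Rightarrow> bool" where
  "G_disjoint G S r \<U> \<longleftrightarrow> pairwise (\<lambda>U U'. G_nbhd G S U r \<inter> U' = {}) \<U>"

definition G_multiplicity_le ::
  "('g, 'm) monoid_scheme \<Rightarrow> 'g set \<Rightarrow> 'x topology \<Rightarrow> real \<Rightarrow> ('g \<times> 'x) set set \<Rightarrow> nat \<Rightarrow> bool" where
  "G_multiplicity_le G S X d \<U> k \<longleftrightarrow>
     (\<forall>g\<in>carrier G. \<forall>x\<in>topspace X. ecard {U\<in>\<U>. (word_cball G S g d \<times> {x}) \<inter> U \<noteq> {}} \<le> enat k)"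

end

theory Submission
  imports Defs
begin

text \<open>
  The heart of the matter is the passage from an invariant open cover \<open>\<I>\<close> of bounded
  \<open>(G, d)\<close>-multiplicity to \<open>n + 1\<close> families that are \<open>(G, r)\<close>-disjoint, carried out in
  \<open>disjoint_families_from_multiplicity\<close> for \<open>d = 2 (n + 1) r\<close>. In geometric language, the cover is
  mapped to its nerve by a map that is Lipschitz in the direction of \<open>G\<close>, and the families are the
  pullbacks of neighbourhoods of the barycentres of the simplices of each fixed dimension.

  Concretely, every member \<open>U\<close> of \<open>\<I>\<close> receives a weight function on \<open>G \<times> X\<close> with values in
  \<open>[0, d]\<close>. It is 1-Lipschitz in \<open>G\<close>, continuous in \<open>X\<close>, equivariant, and positive at \<open>(g, x)\<close> only
  if \<open>U\<close> meets the ball of radius \<open>d\<close> about \<open>g\<close> in \<open>G \<times> {x}\<close>; moreover some weight at each point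
  exceeds \<open>d / 2\<close>. Compactness and Urysohn functions on the slice \<open>{\<one>} \<times> X\<close> give finitely many bump
  functions; translating them by \<open>G\<close> and letting them decay with slope one in \<open>G\<close> gives the weights.
  The piece of a finite set \<open>\<sigma>\<close> of members consists of the points at which all weights of \<open>\<sigma>\<close> exceed
  all other weights by more than \<open>r\<close>. Of the at most \<open>n + 1\<close> positive weights at a point, one is larger
  than \<open>(n + 1) r\<close>; so in the decreasing list of weights, which ends with \<open>0\<close>, two consecutive values
  differ by more than \<open>r\<close> (\<open>exists_gap\<close>), and the pieces with \<open>1 \<le> card \<sigma> \<le> n + 1\<close> cover.
  If \<open>\<sigma> \<noteq> \<tau>\<close> have the same size, there are \<open>U\<close> in \<open>\<sigma>\<close>
  but not in \<open>\<tau>\<close> and \<open>W\<close> in \<open>\<tau>\<close> but not in \<open>\<sigma>\<close>; the difference of their weights is above \<open>r\<close> on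
  one piece and below \<open>- r\<close> on the other, so the Lipschitz condition keeps the pieces at distance
  more than \<open>r\<close>. The stabiliser of a nonempty piece is the stabiliser of the finite set \<open>\<sigma>\<close>.

  The two hypotheses differ only in the reason why the stabiliser of \<open>\<sigma>\<close> is in the family. Under (1), a
  cover with Lebesgue number \<open>d\<close> is shrunk by \<open>d\<close>; this yields (3), and a ball of radius \<open>d\<close> meeting two
  shrunk translates of \<open>U\<close> has its centre in the two translates themselves, which therefore agree. So
  an element that preserves \<open>\<sigma>\<close> fixes each of its members. Under (3) the stabiliser of \<open>\<sigma>\<close> may permute
  the members; as these are finitely many, the elements fixing a given member form a subgroup of
  finite index in it, which suffices if the family is virtually closed.
  Finally, (2) implies (1) by thickening families that are
  \<open>(G, r)\<close>-disjoint for some \<open>r > 2 \<alpha>\<close> by \<open>\<alpha>\<close>.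
\<close>

locale fg_group_space = group G
  for G :: "('g, 'm) monoid_scheme" (structure) +
  fixes S :: "'g set" and X :: "'x topology" and \<phi> :: "'g \<Rightarrow> 'x \<Rightarrow> 'x"
  assumes finite_gens: "finite S"
    and gens_closed: "S \<subseteq> carrier G"
    and gens_generate: "generate G S = carrier G"
    and G_space: "G_space G X \<phi>"
begin

section \<open>The word metric\<close>

abbreviation gdist :: "'g \<Rightarrow> 'g \<Rightarrow> real"
  where "gdist \<equiv> word_dist G S"

abbreviation gball :: "'g \<Rightarrow> real \<Rightarrow> 'g set"
  where "gball \<equiv> word_cball G S"

abbreviation letters :: "'g set"
  where "letters \<equiv> S \<union> m_inv G ` S"

abbreviation word_prod :: "'g list \<Rightarrow> 'g"
  where "word_prod ws \<equiv> foldr (mult G) ws \<one>"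

lemma letters_closed: "letters \<subseteq> carrier G"
  using gens_closed by auto

lemma word_prod_closed: "set ws \<subseteq> carrier G \<Longrightarrow> word_prod ws \<in> carrier G"
  by (induction ws) auto

lemma foldr_mult:
  "set ws \<subseteq> carrier G \<Longrightarrow> g \<in> carrier G \<Longrightarrow> foldr (mult G) ws g = word_prod ws \<otimes> g"
  by (induction ws) (auto simp: word_prod_closed m_assoc)

lemma word_prod_append:
  "set us \<subseteq> carrier G \<Longrightarrow> set vs \<subseteq> carrier G \<Longrightarrow>
     word_prod (us @ vs) = word_prod us \<otimes> word_prod vs"
  by (simp add: foldr_mult[of us "word_prod vs"] word_prod_closed)

lemma word_prod_inv:
  "set ws \<subseteq> carrier G \<Longrightarrow> word_prod (map (m_inv G) (rev ws)) = inv (word_prod ws)"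
proof (induction ws)
  case (Cons w ws)
  have "word_prod (map (m_inv G) (rev (w # ws)))
      = word_prod (map (m_inv G) (rev ws)) \<otimes> word_prod [inv w]"
    using Cons.prems by (subst word_prod_append[symmetric]) auto
  then show ?case
    using Cons by (simp add: inv_mult_group word_prod_closed)
qed simp

lemma ex_word:
  assumes "g \<in> carrier G"
  shows "\<exists>ws. set ws \<subseteq> letters \<and> word_prod ws = g"
proof -
  have "g \<in> generate G S"
    using assms gens_generate by simp
  then show ?thesis
  proof induction
    case one
    show ?case by (rule exI[of _ "[]"]) simp
  next
    case (incl h)
    then show ?case using gens_closed by (intro exI[of _ "[h]"]) auto
  next
    case (inv h)
    then show ?case using gens_closed by (intro exI[of _ "[inv h]"]) auto
  next
    case (eng g h)
    then obtain us vs where "set us \<subseteq> letters" "word_prod us = g" "set vs \<subseteq> letters" "word_prod vs = h"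
      by blast
    then show ?case
      using letters_closed by (intro exI[of _ "us @ vs"]) (subst word_prod_append, auto)
  qed
qed

lemma shortest_word:
  assumes "g \<in> carrier G"
  obtains ws where "set ws \<subseteq> letters" "length ws = word_length G S g" "word_prod ws = g"
proof -
  have "\<exists>k ws. set ws \<subseteq> letters \<and> length ws = k \<and> word_prod ws = g"
    using ex_word[OF assms] by blast
  from LeastI_ex[OF this] show ?thesis
    using that unfolding word_length_def by blast
qed

lemma word_length_le: "set ws \<subseteq> letters \<Longrightarrow> word_length G S (word_prod ws) \<le> length ws"
  unfolding word_length_def by (rule Least_le) blast

lemma word_length_one: "word_length G S \<one> = 0"
  using word_length_le[of "[]"] by simp

lemma word_length_mult:
  assumes "g \<in> carrier G" "h \<in> carrier G"
  shows "word_length G S (g \<otimes> h) \<le> word_length G S g + word_length G S h"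
proof -
  obtain us vs where "set us \<subseteq> letters" "length us = word_length G S g" "word_prod us = g"
      "set vs \<subseteq> letters" "length vs = word_length G S h" "word_prod vs = h"
    using shortest_word assms by metis
  moreover from this have "word_prod (us @ vs) = g \<otimes> h"
    using letters_closed by (subst word_prod_append) auto
  ultimately show ?thesis
    using word_length_le[of "us @ vs"] by (simp del: foldr_append)
qed

lemma word_length_inv_le:
  assumes "g \<in> carrier G"
  shows "word_length G S (inv g) \<le> word_length G S g"
proof -
  obtain ws where ws: "set ws \<subseteq> letters" "length ws = word_length G S g" "word_prod ws = g"
    using shortest_word[OF assms] by blast
  have "set (map (m_inv G) (rev ws)) \<subseteq> letters"
  proof
    fix w assume "w \<in> set (map (m_inv G) (rev ws))"
    then obtain v where v: "v \<in> set ws" "w = inv v" by auto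
    with ws(1) have "v \<in> letters" by blast
    then show "w \<in> letters" using v(2) gens_closed by auto
  qed
  then show ?thesis
    using word_length_le[of "map (m_inv G) (rev ws)"] ws letters_closed word_prod_inv[of ws]
    by auto
qed

lemma word_length_inv:
  "g \<in> carrier G \<Longrightarrow> word_length G S (inv g) = word_length G S g"
  using word_length_inv_le[of g] word_length_inv_le[of "inv g"] by simp

lemma gdist_nonneg: "0 \<le> gdist g h"
  by (simp add: word_dist_def)

lemma gdist_self: "g \<in> carrier G \<Longrightarrow> gdist g g = 0"
  by (simp add: word_dist_def word_length_one)

lemma gdist_sym: "g \<in> carrier G \<Longrightarrow> h \<in> carrier G \<Longrightarrow> gdist g h = gdist h g"
  using word_length_inv[of "inv g \<otimes> h"] by (simp add: word_dist_def inv_mult_group)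

lemma gdist_triangle:
  assumes "g \<in> carrier G" "h \<in> carrier G" "k \<in> carrier G"
  shows "gdist g k \<le> gdist g h + gdist h k"
proof -
  have "(inv g \<otimes> h) \<otimes> (inv h \<otimes> k) = inv g \<otimes> k"
    using assms by (simp add: m_assoc) (simp add: m_assoc[symmetric])
  then show ?thesis
    using word_length_mult[of "inv g \<otimes> h" "inv h \<otimes> k"] assms
    unfolding word_dist_def by simp
qed

lemma gdist_translate:
  assumes "k \<in> carrier G" "g \<in> carrier G" "h \<in> carrier G"
  shows "gdist (k \<otimes> g) (k \<otimes> h) = gdist g h"
proof -
  have "inv (k \<otimes> g) \<otimes> (k \<otimes> h) = inv g \<otimes> h"
    using assms by (simp add: inv_mult_group m_assoc) (simp add: m_assoc[symmetric])
  then show ?thesis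
    by (simp add: word_dist_def)
qed

lemma gball_iff: "h \<in> gball g r \<longleftrightarrow> h \<in> carrier G \<and> gdist g h \<le> r"
  by (simp add: word_cball_def)

lemma gball_closed: "h \<in> gball g r \<Longrightarrow> h \<in> carrier G"
  by (simp add: gball_iff)

lemma center_in_gball: "g \<in> carrier G \<Longrightarrow> 0 \<le> r \<Longrightarrow> g \<in> gball g r"
  by (simp add: gball_iff gdist_self)

lemma gball_sym: "g \<in> carrier G \<Longrightarrow> h \<in> gball g r \<Longrightarrow> g \<in> gball h r"
  by (metis gball_iff gdist_sym)

lemma gball_trans:
  "g \<in> carrier G \<Longrightarrow> h \<in> gball g r \<Longrightarrow> k \<in> gball h s \<Longrightarrow> k \<in> gball g (r + s)"
  using gdist_triangle[of g h k] by (auto simp: gball_iff)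

lemma gball_translate:
  "k \<in> carrier G \<Longrightarrow> g \<in> carrier G \<Longrightarrow> h \<in> carrier G \<Longrightarrow>
     k \<otimes> h \<in> gball (k \<otimes> g) r \<longleftrightarrow> h \<in> gball g r"
  by (simp add: gball_iff gdist_translate)

lemma gball_translate_inv:
  assumes "k \<in> carrier G" "g \<in> carrier G" "h \<in> carrier G"
  shows "inv k \<otimes> h \<in> gball (inv k \<otimes> g) r \<longleftrightarrow> h \<in> gball g r"
  by (rule gball_translate) (use assms in auto)

lemma finite_gball:
  assumes "g \<in> carrier G"
  shows "finite (gball g r)"
proof (rule finite_subset)
  let ?W = "{ws. set ws \<subseteq> letters \<and> length ws \<le> nat \<lfloor>r\<rfloor>}"
  show "finite ((\<lambda>ws. g \<otimes> word_prod ws) ` ?W)"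
    using finite_gens by (intro finite_imageI finite_lists_length_le) auto
  show "gball g r \<subseteq> (\<lambda>ws. g \<otimes> word_prod ws) ` ?W"
  proof
    fix h assume h: "h \<in> gball g r"
    then have hG: "h \<in> carrier G" and "real (word_length G S (inv g \<otimes> h)) \<le> r"
      by (auto simp: gball_iff word_dist_def)
    then have "word_length G S (inv g \<otimes> h) \<le> nat \<lfloor>r\<rfloor>"
      by linarith
    moreover obtain ws where "set ws \<subseteq> letters" "length ws = word_length G S (inv g \<otimes> h)"
        "word_prod ws = inv g \<otimes> h"
      using shortest_word[of "inv g \<otimes> h"] assms hG by auto
    moreover have "h = g \<otimes> (inv g \<otimes> h)"
      using assms hG by (simp add: m_assoc[symmetric])
    ultimately show "h \<in> (\<lambda>ws. g \<otimes> word_prod ws) ` ?W"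
      by (intro image_eqI[of _ _ ws]) auto
  qed
qed


section \<open>The diagonal action on subsets of the product\<close>

abbreviation Y :: "('g \<times> 'x) set"
  where "Y \<equiv> carrier G \<times> topspace X"

abbreviation translate :: "'g \<Rightarrow> ('g \<times> 'x) set \<Rightarrow> ('g \<times> 'x) set"
  where "translate g U \<equiv> diag_action G X \<phi> g ` U"

lemma topspace_prod_space: "topspace (prod_space G X) = Y"
  by (simp add: prod_space_def)

sublocale base: group_action G "topspace X" \<phi>
  using G_space by (simp add: G_space_def)

sublocale diag: group_action G Y "diag_action G X \<phi>"
  using group_action_diag_action[OF base.group_action_axioms] by (simp add: topspace_prod_space)

lemma action_continuous: "g \<in> carrier G \<Longrightarrow> continuous_map X X (\<phi> g)"
  using G_space by (simp add: G_space_def)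

lemma action_closed: "g \<in> carrier G \<Longrightarrow> x \<in> topspace X \<Longrightarrow> \<phi> g x \<in> topspace X"
  using base.element_image by blast

lemma action_mult:
  "g \<in> carrier G \<Longrightarrow> h \<in> carrier G \<Longrightarrow> x \<in> topspace X \<Longrightarrow> \<phi> (g \<otimes> h) x = \<phi> g (\<phi> h x)"
  by (simp add: base.composition_rule)

lemma action_one: "x \<in> topspace X \<Longrightarrow> \<phi> \<one> x = x"
  using base.id_eq_one by (metis restrict_apply')

lemma action_inv_cancel: "g \<in> carrier G \<Longrightarrow> x \<in> topspace X \<Longrightarrow> \<phi> (inv g) (\<phi> g x) = x"
  using action_mult[of "inv g" g x] by (simp add: action_one)

lemma action_cancel_inv: "g \<in> carrier G \<Longrightarrow> x \<in> topspace X \<Longrightarrow> \<phi> g (\<phi> (inv g) x) = x"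
  using action_mult[of g "inv g" x] by (simp add: action_one)

lemma diag_action_apply:
  "g \<in> carrier G \<Longrightarrow> x \<in> topspace X \<Longrightarrow> diag_action G X \<phi> k (g, x) = (k \<otimes> g, \<phi> k x)"
  by (simp add: diag_action_def)

lemma mult_inv_cancel: "g \<in> carrier G \<Longrightarrow> h \<in> carrier G \<Longrightarrow> g \<otimes> (inv g \<otimes> h) = h"
  by (simp add: m_assoc[symmetric])

lemma inv_mult_cancel: "g \<in> carrier G \<Longrightarrow> h \<in> carrier G \<Longrightarrow> inv g \<otimes> (g \<otimes> h) = h"
  by (simp add: m_assoc[symmetric])

lemma mem_translate:
  assumes "k \<in> carrier G" "U \<subseteq> Y"
  shows "(g, x) \<in> translate k U \<longleftrightarrow> (g, x) \<in> Y \<and> (inv k \<otimes> g, \<phi> (inv k) x) \<in> U"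
proof
  assume "(g, x) \<in> translate k U"
  then obtain h z where hz: "(h, z) \<in> U" "(g, x) = diag_action G X \<phi> k (h, z)"
    by auto
  then have "h \<in> carrier G" "z \<in> topspace X"
    using assms(2) by auto
  with hz show "(g, x) \<in> Y \<and> (inv k \<otimes> g, \<phi> (inv k) x) \<in> U"
    using assms(1) by (simp add: diag_action_apply action_closed action_inv_cancel inv_mult_cancel)
next
  assume a: "(g, x) \<in> Y \<and> (inv k \<otimes> g, \<phi> (inv k) x) \<in> U"
  then have "diag_action G X \<phi> k (inv k \<otimes> g, \<phi> (inv k) x) = (g, x)"
    using assms by (auto simp: diag_action_apply action_closed action_cancel_inv mult_inv_cancel)
  then show "(g, x) \<in> translate k U"
    using a by (metis image_eqI)
qed

lemma translate_closed: "k \<in> carrier G \<Longrightarrow> U \<subseteq> Y \<Longrightarrow> translate k U \<subseteq> Y"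
  using mem_translate by (meson subrelI)

lemma translate_mult:
  assumes "g \<in> carrier G" "h \<in> carrier G" "U \<subseteq> Y"
  shows "translate (g \<otimes> h) U = translate g (translate h U)"
  unfolding image_image
  using assms by (intro image_cong) (auto simp: diag.composition_rule)

lemma translate_one:
  assumes "U \<subseteq> Y"
  shows "translate \<one> U = U"
proof -
  have "diag_action G X \<phi> \<one> y = y" if "y \<in> U" for y
    using assms that by (cases y) (auto simp: diag_action_apply action_one)
  then show ?thesis
    by simp
qed

lemma translate_inv_cancel:
  "g \<in> carrier G \<Longrightarrow> U \<subseteq> Y \<Longrightarrow> translate (inv g) (translate g U) = U"
  using translate_mult[of "inv g" g U] translate_one[of U] by simp

lemma translate_cancel_inv:
  "g \<in> carrier G \<Longrightarrow> U \<subseteq> Y \<Longrightarrow> translate g (translate (inv g) U) = U"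
  using translate_mult[of g "inv g" U] translate_one[of U] by simp

lemma translate_Int:
  "g \<in> carrier G \<Longrightarrow> U \<subseteq> Y \<Longrightarrow> V \<subseteq> Y \<Longrightarrow> translate g (U \<inter> V) = translate g U \<inter> translate g V"
  by (intro inj_on_image_Int[of _ Y]) (auto simp: diag.inj_prop)

abbreviation translates :: "'g \<Rightarrow> ('g \<times> 'x) set set \<Rightarrow> ('g \<times> 'x) set set"
  where "translates g \<sigma> \<equiv> (\<lambda>U. translate g U) ` \<sigma>"

abbreviation set_stab :: "('g \<times> 'x) set \<Rightarrow> 'g set"
  where "set_stab U \<equiv> {g \<in> carrier G. translate g U = U}"

abbreviation coll_stab :: "('g \<times> 'x) set set \<Rightarrow> 'g set"
  where "coll_stab \<sigma> \<equiv> {g \<in> carrier G. translates g \<sigma> = \<sigma>}"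

lemma translates_mult:
  assumes "g \<in> carrier G" "h \<in> carrier G" "\<sigma> \<subseteq> Pow Y"
  shows "translates (g \<otimes> h) \<sigma> = translates g (translates h \<sigma>)"
proof -
  have "translates (g \<otimes> h) \<sigma> = (\<lambda>U. translate g (translate h U)) ` \<sigma>"
    using assms by (intro image_cong refl translate_mult) auto
  then show ?thesis
    by (simp only: image_image)
qed

lemma translates_one: "\<sigma> \<subseteq> Pow Y \<Longrightarrow> translates \<one> \<sigma> = \<sigma>"
  using image_cong[of \<sigma> \<sigma> "translate \<one>" "\<lambda>U. U"] translate_one by (metis PowD image_ident subsetD)

lemma stab_subgroup:
  assumes one: "f \<one> z = z"
    and mult: "\<And>g h. g \<in> carrier G \<Longrightarrow> h \<in> carrier G \<Longrightarrow> f (g \<otimes> h) z = f g (f h z)"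
  shows "subgroup {g \<in> carrier G. f g z = z} G"
proof (rule subgroupI)
  fix a assume "a \<in> {g \<in> carrier G. f g z = z}"
  then show "inv a \<in> {g \<in> carrier G. f g z = z}"
    using mult[of "inv a" a] one by simp
qed (use one mult in auto)

lemma set_stab_subgroup: "U \<subseteq> Y \<Longrightarrow> subgroup (set_stab U) G"
  by (rule stab_subgroup) (auto simp only: translate_one translate_mult)

lemma coll_stab_subgroup: "\<sigma> \<subseteq> Pow Y \<Longrightarrow> subgroup (coll_stab \<sigma>) G"
  by (rule stab_subgroup) (auto simp only: translates_one translates_mult)

text \<open>Comparing \<open>gU\<close> with \<open>hU\<close> is the same as comparing \<open>(inv h) g U\<close> with \<open>U\<close>.\<close>

lemma F_subset_iff:
  assumes "U \<subseteq> Y"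
  shows "F_subset G Y (diag_action G X \<phi>) F U \<longleftrightarrow>
    (\<forall>g\<in>carrier G. translate g U \<inter> U \<noteq> {} \<longrightarrow> translate g U = U) \<and> set_stab U \<in> F"
proof -
  have A: "translate g U = translate h U \<or> disjnt (translate g U) (translate h U)"
    if g: "g \<in> carrier G" and h: "h \<in> carrier G"
      and *: "\<forall>k\<in>carrier G. translate k U \<inter> U \<noteq> {} \<longrightarrow> translate k U = U" for g h
  proof (cases "disjnt (translate g U) (translate h U)")
    case False
    define k where "k = inv h \<otimes> g"
    have k: "k \<in> carrier G" "translate g U = translate h (translate k U)"
      using g h assms by (auto simp only: k_def m_closed inv_closed mult_inv_cancel translate_mult[symmetric])
    then have "translate h (translate k U \<inter> U) \<noteq> {}"
      using False h assms translate_Int[of h "translate k U" U] translate_closed[of k U]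
      by (simp add: disjnt_def)
    then have "translate k U = U"
      using * k by blast
    then show ?thesis
      using k by simp
  qed simp
  have B: "translate g U = U"
    if "g \<in> carrier G" "translate g U \<inter> U \<noteq> {}"
      "\<forall>g\<in>carrier G. \<forall>h\<in>carrier G. translate g U = translate h U \<or> disjnt (translate g U) (translate h U)" for g
    using that translate_one[OF assms] one_closed unfolding disjnt_def by metis
  have "(\<forall>g\<in>carrier G. \<forall>h\<in>carrier G. translate g U = translate h U \<or> disjnt (translate g U) (translate h U))
    \<longleftrightarrow> (\<forall>g\<in>carrier G. translate g U \<inter> U \<noteq> {} \<longrightarrow> translate g U = U)"
    by (rule iffI; intro ballI impI) (erule (2) B, erule (2) A[rotated 2])
  then show ?thesis
    using assms by (simp add: F_subset_def stabilizer_def)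
qed

lemma F_famI:
  assumes "\<And>U. U \<in> \<U> \<Longrightarrow> U \<subseteq> Y"
    and "\<And>U g. U \<in> \<U> \<Longrightarrow> g \<in> carrier G \<Longrightarrow> translate g U \<inter> U \<noteq> {} \<Longrightarrow> translate g U = U"
    and "\<And>U. U \<in> \<U> \<Longrightarrow> set_stab U \<in> F"
    and "\<And>U g. U \<in> \<U> \<Longrightarrow> g \<in> carrier G \<Longrightarrow> translate g U \<in> \<U>"
  shows "F_fam G Y (diag_action G X \<phi>) F \<U>"
  using assms F_subset_iff unfolding F_fam_def by simp

lemma F_famD:
  assumes "F_fam G Y (diag_action G X \<phi>) F \<U>" "U \<in> \<U>"
  shows "U \<subseteq> Y"
    and "\<And>g. g \<in> carrier G \<Longrightarrow> translate g U \<inter> U \<noteq> {} \<Longrightarrow> translate g U = U"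
    and "set_stab U \<in> F"
    and "\<And>g. g \<in> carrier G \<Longrightarrow> translate g U \<in> \<U>"
proof -
  have U: "F_subset G Y (diag_action G X \<phi>) F U"
    using assms unfolding F_fam_def by blast
  then show "U \<subseteq> Y"
    unfolding F_subset_def by blast
  then show "\<And>g. g \<in> carrier G \<Longrightarrow> translate g U \<inter> U \<noteq> {} \<Longrightarrow> translate g U = U" "set_stab U \<in> F"
    using U F_subset_iff by auto
  show "\<And>g. g \<in> carrier G \<Longrightarrow> translate g U \<in> \<U>"
    using assms unfolding F_fam_def by blast
qed

text \<open>As \<open>G\<close> is discrete, openness can be checked on each slice \<open>{g} \<times> X\<close>. All topological
  arguments below take place in a single copy of \<open>X\<close>.\<close>

lemma openin_prod_space_iff:
  "openin (prod_space G X) U \<longleftrightarrow>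
     U \<subseteq> Y \<and> (\<forall>g\<in>carrier G. openin X {x \<in> topspace X. (g, x) \<in> U})" (is "?L \<longleftrightarrow> ?R")
proof
  assume L: ?L
  have "continuous_map X (prod_space G X) (\<lambda>x. (g, x))" if "g \<in> carrier G" for g
    using that by (auto simp: prod_space_def continuous_map_pairedI)
  then show ?R
    using L openin_continuous_map_preimage openin_subset[OF L] by (fastforce simp: topspace_prod_space)
next
  assume R: ?R
  show ?L
    unfolding prod_space_def openin_prod_topology_alt
  proof (intro allI impI)
    fix g x assume "(g, x) \<in> U"
    then show "\<exists>A B. openin (discrete_topology (carrier G)) A \<and> openin X B \<and> g \<in> A \<and> x \<in> B \<and> A \<times> B \<subseteq> U"
      using R by (intro exI[of _ "{g}"] exI[of _ "{x \<in> topspace X. (g, x) \<in> U}"]) auto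
  qed
qed

end


section \<open>Reformulation of the dimension bound\<close>

lemma ecard_le_iff: "ecard A \<le> enat k \<longleftrightarrow> finite A \<and> card A \<le> k"
  by (simp add: ecard_def)

lemma fam_dim_le_iff:
  "fam_dim Z \<U> \<le> ereal (real n) \<longleftrightarrow> (\<forall>y\<in>Z. ecard {U \<in> \<U>. y \<in> U} \<le> enat (n + 1))"
proof -
  have "fam_dim Z \<U> \<le> ereal (real n) \<longleftrightarrow>
      ereal_of_enat (SUP y\<in>Z. ecard {U \<in> \<U>. y \<in> U}) \<le> ereal_of_enat (enat (n + 1))"
    by (cases "SUP y\<in>Z. ecard {U \<in> \<U>. y \<in> U}") (auto simp: fam_dim_def one_ereal_def)
  also have "\<dots> \<longleftrightarrow> (SUP y\<in>Z. ecard {U \<in> \<U>. y \<in> U}) \<le> enat (n + 1)"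
    by (simp only: ereal_of_enat_le_iff)
  finally show ?thesis
    by (simp only: SUP_le_iff)
qed

text \<open>The dimension is an infimum over integers, and the set of admissible integers is upward closed;
  hence an upper bound \<open>n\<close> is itself admissible.\<close>

lemma eq_asdim_le_iff:
  "eq_asdim G S F X \<phi> \<le> ereal (real n) \<longleftrightarrow>
     (\<forall>\<alpha>\<ge>0. \<exists>\<U>. open_F_cover G (prod_space G X) (diag_action G X \<phi>) F \<U> \<and>
        (\<forall>y\<in>topspace (prod_space G X). ecard {U \<in> \<U>. y \<in> U} \<le> enat (n + 1)) \<and>
        G_Lebesgue_number G S X \<U> \<alpha>)" (is "_ \<longleftrightarrow> ?R")
proof -
  define P where "P m \<longleftrightarrow> (\<forall>\<alpha>\<ge>0. \<exists>\<U>. open_F_cover G (prod_space G X) (diag_action G X \<phi>) F \<U> \<and>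
      fam_dim (topspace (prod_space G X)) \<U> \<le> ereal (of_int m) \<and> G_Lebesgue_number G S X \<U> \<alpha>)"
    for m :: int
  have mono: "P m \<Longrightarrow> m \<le> m' \<Longrightarrow> P m'" for m m'
    unfolding P_def by (meson ereal_less_eq(3) of_int_le_iff order_trans)
  have R: "?R \<longleftrightarrow> P (int n)"
    by (simp add: P_def fam_dim_le_iff)
  have eq: "eq_asdim G S F X \<phi> = Inf {ereal (of_int m) |m. P m}"
    by (simp add: eq_asdim_def P_def)
  show ?thesis
  proof
    assume "eq_asdim G S F X \<phi> \<le> ereal (real n)"
    then have "Inf {ereal (of_int m) |m. P m} < ereal (real n + 1)"
      unfolding eq by (rule order_le_less_trans) simp
    then obtain m where "P m" "real_of_int m < real n + 1"
      by (auto simp: Inf_less_iff)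
    then have "P (int n)"
      by - (rule mono[of m], assumption, linarith)
    then show ?R
      using R by simp
  next
    assume ?R
    then show "eq_asdim G S F X \<phi> \<le> ereal (real n)"
      unfolding eq R by (intro Inf_lower) force
  qed
qed

context fg_group_space
begin

section \<open>Thickening and shrinking in the group direction\<close>

abbreviation nbhd :: "('g \<times> 'x) set \<Rightarrow> real \<Rightarrow> ('g \<times> 'x) set"
  where "nbhd \<equiv> G_nbhd G S"

definition shrink :: "('g \<times> 'x) set \<Rightarrow> real \<Rightarrow> ('g \<times> 'x) set"
  where "shrink U r = {(g, x) \<in> Y. gball g r \<times> {x} \<subseteq> U}"

lemma mem_nbhd:
  assumes "U \<subseteq> Y"
  shows "(g, x) \<in> nbhd U r \<longleftrightarrow> g \<in> carrier G \<and> (\<exists>h\<in>gball g r. (h, x) \<in> U)" (is "_ \<longleftrightarrow> ?R")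
proof
  assume "(g, x) \<in> nbhd U r"
  then obtain h where h: "(h, x) \<in> U" "g \<in> gball h r"
    by (auto simp: G_nbhd_def)
  then have "h \<in> gball g r"
    using assms gball_sym[of h g r] by auto
  then show ?R
    using h gball_closed by blast
next
  assume ?R
  then obtain h where "(h, x) \<in> U" "g \<in> gball h r"
    using gball_sym by blast
  then show "(g, x) \<in> nbhd U r"
    by (auto simp: G_nbhd_def)
qed

lemma mem_shrink: "(g, x) \<in> shrink U r \<longleftrightarrow> (g, x) \<in> Y \<and> (\<forall>h\<in>gball g r. (h, x) \<in> U)"
  by (auto simp: shrink_def)

lemma nbhd_closed: "U \<subseteq> Y \<Longrightarrow> nbhd U r \<subseteq> Y"
  by (auto simp: mem_nbhd)

lemma shrink_closed: "shrink U r \<subseteq> Y"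
  by (auto simp: shrink_def)

lemma subset_nbhd:
  assumes "U \<subseteq> Y" "0 \<le> r"
  shows "U \<subseteq> nbhd U r"
proof (rule subrelI)
  fix g x assume "(g, x) \<in> U"
  then show "(g, x) \<in> nbhd U r"
    using assms center_in_gball[of g r] by (auto simp: mem_nbhd)
qed

lemma shrink_subset: "0 \<le> r \<Longrightarrow> shrink U r \<subseteq> U"
  using center_in_gball by (intro subrelI) (auto simp: mem_shrink)

lemma ball_gball_inv_translate:
  assumes "k \<in> carrier G" "g \<in> carrier G"
  shows "(\<forall>h\<in>gball (inv k \<otimes> g) r. P h) \<longleftrightarrow> (\<forall>h\<in>gball g r. P (inv k \<otimes> h))"
proof -
  have "gball (inv k \<otimes> g) r = (\<lambda>h. inv k \<otimes> h) ` gball g r"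
  proof (intro equalityI subsetI)
    fix h assume h: "h \<in> gball (inv k \<otimes> g) r"
    then have "h = inv k \<otimes> (k \<otimes> h)" "k \<otimes> h \<in> gball g r"
      using assms gball_closed[OF h] gball_translate[of k "inv k \<otimes> g" h r]
      by (simp_all add: inv_mult_cancel mult_inv_cancel)
    then show "h \<in> (\<lambda>h. inv k \<otimes> h) ` gball g r"
      by (rule image_eqI)
  qed (use assms gball_closed gball_translate_inv in auto)
  then show ?thesis
    by simp
qed

lemma bex_gball_inv_translate:
  assumes "k \<in> carrier G" "g \<in> carrier G"
  shows "(\<exists>h\<in>gball (inv k \<otimes> g) r. P h) \<longleftrightarrow> (\<exists>h\<in>gball g r. P (inv k \<otimes> h))"
  using ball_gball_inv_translate[OF assms, of r "\<lambda>h. \<not> P h"] by blast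

lemma translate_nbhd:
  assumes k: "k \<in> carrier G" and U: "U \<subseteq> Y"
  shows "translate k (nbhd U r) = nbhd (translate k U) r"
proof -
  have "(g, x) \<in> translate k (nbhd U r) \<longleftrightarrow> (g, x) \<in> nbhd (translate k U) r" for g x
    using k U nbhd_closed[OF U, of r] translate_closed[OF k U]
    by (cases "g \<in> carrier G") (auto simp: mem_translate mem_nbhd bex_gball_inv_translate[OF k] dest: gball_closed)
  then show ?thesis
    by (intro subset_antisym subrelI) (simp_all only:)
qed

lemma translate_shrink:
  assumes k: "k \<in> carrier G" and U: "U \<subseteq> Y"
  shows "translate k (shrink U r) = shrink (translate k U) r"
proof -
  have "(g, x) \<in> translate k (shrink U r) \<longleftrightarrow> (g, x) \<in> shrink (translate k U) r" for g x
    using k U shrink_closed[of U r]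
    by (cases "g \<in> carrier G") (auto simp: mem_translate mem_shrink ball_gball_inv_translate[OF k] action_closed dest: gball_closed)
  then show ?thesis
    by (intro subset_antisym subrelI) (simp_all only:)
qed

lemma openin_nbhd:
  assumes "openin (prod_space G X) U"
  shows "openin (prod_space G X) (nbhd U r)"
proof -
  have U: "U \<subseteq> Y" "\<And>g. g \<in> carrier G \<Longrightarrow> openin X {x \<in> topspace X. (g, x) \<in> U}"
    using assms by (auto simp: openin_prod_space_iff)
  have "openin X {x \<in> topspace X. (g, x) \<in> nbhd U r}" if g: "g \<in> carrier G" for g
  proof -
    have "{x \<in> topspace X. (g, x) \<in> nbhd U r} = (\<Union>h\<in>gball g r. {x \<in> topspace X. (h, x) \<in> U})"
      using g by (auto simp: mem_nbhd[OF U(1)])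
    then show ?thesis
      using U(2) gball_closed by auto
  qed
  then show ?thesis
    using nbhd_closed[OF U(1)] by (simp add: openin_prod_space_iff)
qed

text \<open>This uses that balls are finite: a slice of the shrunk set is a finite intersection of slices of
  the given set.\<close>

lemma openin_shrink:
  assumes "openin (prod_space G X) U"
  shows "openin (prod_space G X) (shrink U r)"
proof -
  have U: "\<And>g. g \<in> carrier G \<Longrightarrow> openin X {x \<in> topspace X. (g, x) \<in> U}"
    using assms by (auto simp: openin_prod_space_iff)
  have "openin X {x \<in> topspace X. (g, x) \<in> shrink U r}" if g: "g \<in> carrier G" for g
  proof -
    have "{x \<in> topspace X. (g, x) \<in> shrink U r}
        = (\<Inter>h\<in>gball g r. {x \<in> topspace X. (h, x) \<in> U}) \<inter> topspace X"
      using g by (auto simp: mem_shrink)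
    then show ?thesis
      using openin_INT[OF finite_gball[OF g]] U gball_closed by (metis (no_types, lifting))
  qed
  then show ?thesis
    using shrink_closed by (simp add: openin_prod_space_iff)
qed

lemma open_F_cover_iff:
  "open_F_cover G (prod_space G X) (diag_action G X \<phi>) F \<U> \<longleftrightarrow>
     F_fam G Y (diag_action G X \<phi>) F \<U> \<and> (\<forall>U\<in>\<U>. openin (prod_space G X) U) \<and> \<Union>\<U> = Y"
  by (simp add: open_F_cover_def open_cover_def topspace_prod_space)

text \<open>Thickening by \<open>\<alpha>\<close> makes \<open>\<alpha>\<close> a Lebesgue number, and sets that are \<open>r\<close>-disjoint for some
  \<open>r \<ge> 2 \<alpha>\<close> remain disjoint. So each family contributes at most one member at each point, and different translates of a member stay
  disjoint, which also keeps the stabilisers unchanged.\<close>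

lemma cover_from_disjoint_families:
  assumes \<alpha>: "0 \<le> \<alpha>" "2 * \<alpha> \<le> r"
    and I: "\<And>i. i \<le> n \<Longrightarrow> F_fam G Y (diag_action G X \<phi>) F (\<I> i)"
    and disj: "\<And>i. i \<le> n \<Longrightarrow> G_disjoint G S r (\<I> i)"
    and cov: "open_cover (prod_space G X) (\<Union>i\<le>n. \<I> i)"
  shows "\<exists>\<U>. open_F_cover G (prod_space G X) (diag_action G X \<phi>) F \<U> \<and>
        (\<forall>y\<in>topspace (prod_space G X). ecard {U \<in> \<U>. y \<in> U} \<le> enat (n + 1)) \<and>
        G_Lebesgue_number G S X \<U> \<alpha>"
proof -
  define \<U> where "\<U> = (\<lambda>U. nbhd U \<alpha>) ` (\<Union>i\<le>n. \<I> i)"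
  have sub: "U \<subseteq> Y" if "i \<le> n" "U \<in> \<I> i" for i U
    using F_famD(1)[OF I that(2)] that(1) by blast
  have sep: "U = V" if i: "i \<le> n" and UV: "U \<in> \<I> i" "V \<in> \<I> i"
    and ne: "nbhd U \<alpha> \<inter> nbhd V \<alpha> \<noteq> {}" for i U V
  proof (rule ccontr)
    assume "U \<noteq> V"
    then have empty: "nbhd U r \<inter> V = {}"
      using disj[OF i] UV by (auto simp: G_disjoint_def pairwise_def)
    obtain g x where gx: "(g, x) \<in> nbhd U \<alpha>" "(g, x) \<in> nbhd V \<alpha>"
      using ne by auto
    then obtain h k where h: "h \<in> gball g \<alpha>" "(h, x) \<in> U" and k: "k \<in> gball g \<alpha>" "(k, x) \<in> V"
      and g: "g \<in> carrier G"
      by (auto simp: mem_nbhd[OF sub[OF i UV(1)]] mem_nbhd[OF sub[OF i UV(2)]])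
    have "h \<in> gball k (\<alpha> + \<alpha>)"
      using gball_trans[of k g \<alpha> h \<alpha>] gball_sym[OF g k(1)] h(1) gball_closed[OF k(1)] by simp
    then have "h \<in> gball k r"
      using \<alpha>(2) by (simp add: gball_iff)
    then have "(k, x) \<in> nbhd U r"
      using h(2) gball_closed[OF k(1)] by (auto simp: mem_nbhd[OF sub[OF i UV(1)]])
    then show False
      using empty k(2) by blast
  qed
  have tr: "translate g U = U"
    if i: "i \<le> n" and U: "U \<in> \<I> i" and g: "g \<in> carrier G"
      and ne: "translate g (nbhd U \<alpha>) \<inter> nbhd U \<alpha> \<noteq> {}" for i U g
    using sep[OF i F_famD(4)[OF I[OF i] U g] U] ne by (simp add: translate_nbhd g sub[OF i U])
  have stab: "set_stab (nbhd U \<alpha>) = set_stab U" if i: "i \<le> n" and U: "U \<in> \<I> i" for i U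
  proof (cases "U = {}")
    case True
    then show ?thesis by (simp add: G_nbhd_def)
  next
    case False
    then have "nbhd U \<alpha> \<noteq> {}"
      using subset_nbhd[OF sub[OF i U] \<alpha>(1)] by blast
    then show ?thesis
      using tr[OF i U] translate_nbhd[OF _ sub[OF i U]] by (metis (no_types, lifting) Int_absorb)
  qed
  have "F_fam G Y (diag_action G X \<phi>) F \<U>"
  proof (rule F_famI)
    fix W assume "W \<in> \<U>"
    then obtain i U where iU: "i \<le> n" "U \<in> \<I> i" and W: "W = nbhd U \<alpha>"
      by (auto simp: \<U>_def)
    show "W \<subseteq> Y"
      using nbhd_closed[OF sub[OF iU]] W by simp
    show "set_stab W \<in> F"
      using stab[OF iU] F_famD(3)[OF I iU(2)] iU W by simp
    fix g assume g: "g \<in> carrier G"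
    show "translate g W = W" if "translate g W \<inter> W \<noteq> {}"
      using tr[OF iU g] that translate_nbhd[OF g sub[OF iU]] W by simp
    have "translate g U \<in> \<I> i"
      using F_famD(4)[OF I iU(2) g] iU by simp
    then show "translate g W \<in> \<U>"
      using translate_nbhd[OF g sub[OF iU]] iU(1) W by (auto simp: \<U>_def)
  qed
  moreover have "\<forall>U\<in>\<U>. openin (prod_space G X) U"
    using cov openin_nbhd by (auto simp: \<U>_def open_cover_def)
  moreover have leb: "G_Lebesgue_number G S X \<U> \<alpha>"
    unfolding G_Lebesgue_number_def
  proof (intro ballI)
    fix g x assume gx: "g \<in> carrier G" "x \<in> topspace X"
    then have "(g, x) \<in> (\<Union>(\<Union>i\<le>n. \<I> i))"
      using cov by (simp add: open_cover_def topspace_prod_space)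
    then obtain i U where iU: "i \<le> n" "U \<in> \<I> i" "(g, x) \<in> U"
      by auto
    then have "gball g \<alpha> \<times> {x} \<subseteq> nbhd U \<alpha>"
      by (auto simp: G_nbhd_def)
    then show "\<exists>U\<in>\<U>. gball g \<alpha> \<times> {x} \<subseteq> U"
      using iU by (auto simp: \<U>_def)
  qed
  moreover have "\<Union>\<U> = Y"
  proof
    show "\<Union>\<U> \<subseteq> Y"
      using nbhd_closed[OF sub] by (auto simp: \<U>_def)
    show "Y \<subseteq> \<Union>\<U>"
    proof clarify
      fix g x assume gx: "g \<in> carrier G" "x \<in> topspace X"
      then obtain U where "U \<in> \<U>" "gball g \<alpha> \<times> {x} \<subseteq> U"
        using leb unfolding G_Lebesgue_number_def by blast
      then show "(g, x) \<in> \<Union>\<U>"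
        using center_in_gball[OF gx(1) \<alpha>(1)] by blast
    qed
  qed
  moreover have "ecard {W \<in> \<U>. y \<in> W} \<le> enat (n + 1)" for y
  proof -
    \<comment> \<open>a point determines at most one thickened set in each of the \<open>n + 1\<close> families\<close>
    let ?f = "\<lambda>i. THE W. \<exists>U\<in>\<I> i. y \<in> W \<and> W = nbhd U \<alpha>"
    have "{W \<in> \<U>. y \<in> W} \<subseteq> ?f ` {..n}"
    proof
      fix W assume "W \<in> {W \<in> \<U>. y \<in> W}"
      then obtain i U where iU: "i \<le> n" "U \<in> \<I> i" "W = nbhd U \<alpha>" "y \<in> W"
        by (auto simp: \<U>_def)
      then have "?f i = W"
        using sep[OF iU(1)] by (intro the_equality) blast+
      then show "W \<in> ?f ` {..n}"
        using iU(1) by auto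
    qed
    then have "finite {W \<in> \<U>. y \<in> W}" "card {W \<in> \<U>. y \<in> W} \<le> card {..n}"
      using surj_card_le[of "{..n}" _ ?f] finite_subset[of _ "?f ` {..n}"] by auto
    then show ?thesis
      by (simp add: ecard_le_iff)
  qed
  ultimately show ?thesis
    by (auto simp: open_F_cover_iff)
qed

text \<open>A ball of radius \<open>d\<close> that meets the shrunk set has its centre in the set itself, so the order of
  the cover at the centre bounds the multiplicity. By the same argument a ball meeting the shrinkings
  of two translates of a set forces these translates to agree, since they intersect.\<close>

lemma shrunk_cover:
  assumes d: "0 \<le> d"
    and \<U>: "open_F_cover G (prod_space G X) (diag_action G X \<phi>) F \<U>"
    and dim: "\<And>y. y \<in> Y \<Longrightarrow> ecard {U \<in> \<U>. y \<in> U} \<le> enat k"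
    and leb: "G_Lebesgue_number G S X \<U> d"
  obtains \<I> where "open_F_cover G (prod_space G X) (diag_action G X \<phi>) F \<I>"
    and "G_multiplicity_le G S X d \<I> k"
    and "\<And>U g h x. U \<in> \<I> \<Longrightarrow> g \<in> carrier G \<Longrightarrow> (h, x) \<in> Y \<Longrightarrow>
           gball h d \<times> {x} \<inter> U \<noteq> {} \<Longrightarrow> gball h d \<times> {x} \<inter> translate g U \<noteq> {} \<Longrightarrow> translate g U = U"
proof -
  have fam: "F_fam G Y (diag_action G X \<phi>) F \<U>"
    using \<U> by (simp add: open_F_cover_iff)
  note fam = F_famD[OF fam]
  \<comment> \<open>the empty set is removed because its stabiliser is all of \<open>G\<close>\<close>
  define \<I> where "\<I> = (\<lambda>U. shrink U d) ` \<U> - {{}}"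
  have meet: "(h, x) \<in> U" if "h \<in> carrier G" "gball h d \<times> {x} \<inter> shrink U d \<noteq> {}" for h x U
    using that gball_sym by (auto simp: mem_shrink)
  have stab: "translate g U = U" if "U \<in> \<U>" "g \<in> carrier G" "(h, x) \<in> U" "(h, x) \<in> translate g U" for U g h x
    using fam(2)[of U g] that by blast
  have F: "F_fam G Y (diag_action G X \<phi>) F \<I>"
  proof (rule F_famI)
    fix W assume "W \<in> \<I>"
    then obtain U where U: "U \<in> \<U>" and W: "W = shrink U d" "W \<noteq> {}"
      by (auto simp: \<I>_def)
    show "W \<subseteq> Y"
      using shrink_closed W by simp
    have tr: "translate g W = shrink (translate g U) d" if "g \<in> carrier G" for g
      using that translate_shrink fam(1)[OF U] W by simp
    have eq: "translate g U = U" if g: "g \<in> carrier G" and ne: "translate g W \<inter> W \<noteq> {}" for g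
    proof (rule fam(2)[OF U g])
      show "translate g U \<inter> U \<noteq> {}"
        using ne tr[OF g] shrink_subset[OF d] W by blast
    qed
    have "translate g W = W \<longleftrightarrow> translate g U = U" if g: "g \<in> carrier G" for g
      using eq[OF g] tr[OF g] W by (metis Int_absorb)
    then have "set_stab W = set_stab U"
      by blast
    then show "set_stab W \<in> F"
      using fam(3)[OF U] by simp
    fix g assume g: "g \<in> carrier G"
    show "translate g W = W" if "translate g W \<inter> W \<noteq> {}"
      using eq[OF g that] tr[OF g] W by simp
    show "translate g W \<in> \<I>"
      using tr[OF g] fam(4)[OF U g] W(2) by (auto simp: \<I>_def)
  qed
  have cover: "\<Union>\<I> = Y"
  proof
    show "\<Union>\<I> \<subseteq> Y"
      using shrink_closed by (auto simp: \<I>_def)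
    show "Y \<subseteq> \<Union>\<I>"
    proof clarify
      fix g x assume gx: "g \<in> carrier G" "x \<in> topspace X"
      then obtain U where "U \<in> \<U>" "gball g d \<times> {x} \<subseteq> U"
        using leb unfolding G_Lebesgue_number_def by blast
      then have "U \<in> \<U>" "(g, x) \<in> shrink U d"
        using gx by (auto simp: shrink_def)
      then show "(g, x) \<in> \<Union>\<I>"
        by (auto simp: \<I>_def)
    qed
  qed
  have op: "\<forall>U\<in>\<I>. openin (prod_space G X) U"
    using \<U> openin_shrink by (auto simp: \<I>_def open_F_cover_iff)
  have mult: "G_multiplicity_le G S X d \<I> k"
    unfolding G_multiplicity_le_def
  proof (intro ballI)
    fix g x assume gx: "g \<in> carrier G" "x \<in> topspace X"
    let ?A = "{W \<in> \<I>. gball g d \<times> {x} \<inter> W \<noteq> {}}" and ?B = "{U \<in> \<U>. (g, x) \<in> U}"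
    have B: "finite ?B" "card ?B \<le> k"
      using dim gx by (auto simp: ecard_le_iff)
    have sub: "?A \<subseteq> (\<lambda>U. shrink U d) ` ?B"
      using meet[OF gx(1)] by (auto simp: \<I>_def)
    have "finite ?A"
      by (rule finite_subset[OF sub]) (intro finite_imageI B(1))
    moreover have "card ?A \<le> card ?B"
      by (rule surj_card_le[OF B(1) sub])
    ultimately show "ecard ?A \<le> enat k"
      using B by (simp add: ecard_le_iff)
  qed
  show ?thesis
  proof (rule that[of \<I>])
    show "translate g W = W"
      if W: "W \<in> \<I>" and g: "g \<in> carrier G" and hx: "(h, x) \<in> Y" and m: "gball h d \<times> {x} \<inter> W \<noteq> {}"
      "gball h d \<times> {x} \<inter> translate g W \<noteq> {}" for W g h x
    proof -
      obtain U where U: "U \<in> \<U>" "W = shrink U d"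
        using W by (auto simp: \<I>_def)
      have "translate g W = shrink (translate g U) d"
        using translate_shrink[OF g fam(1)[OF U(1)]] U by simp
      then show ?thesis
        using stab[OF U(1) g, of h x] meet[of h x] m U hx by auto
    qed
  qed (use F cover op mult in \<open>auto simp: open_F_cover_iff\<close>)
qed


section \<open>Stabilisers of finite collections\<close>

lemma coll_stab_in_family:
  assumes "subgroup_family G F" and "\<sigma> \<subseteq> Pow Y" "U \<in> \<sigma>" "set_stab U \<in> F"
    and "\<And>g. g \<in> carrier G \<Longrightarrow> translate g U \<in> \<sigma> \<Longrightarrow> translate g U = U"
  shows "coll_stab \<sigma> \<in> F"
proof -
  have "coll_stab \<sigma> \<subseteq> set_stab U"
    using assms(3,5) by auto
  moreover have "subgroup (coll_stab \<sigma>) G"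
    by (rule coll_stab_subgroup) fact
  moreover have "\<And>H K. H \<in> F \<Longrightarrow> subgroup K G \<Longrightarrow> K \<subseteq> H \<Longrightarrow> K \<in> F"
    using assms(1) unfolding subgroup_family_def by blast
  ultimately show ?thesis
    using assms(4) by blast
qed

text \<open>The stabiliser \<open>H\<close> of \<open>\<sigma>\<close> permutes the finite set \<open>\<sigma>\<close>, so by the orbit-stabiliser principle the
  elements of \<open>H\<close> fixing \<open>U\<close> form a subgroup \<open>K\<close> of finite index.\<close>

lemma coll_stab_in_virtually_closed_family:
  assumes "subgroup_family G F" "virtually_closed G F"
    and "\<sigma> \<subseteq> Pow Y" "finite \<sigma>" "U \<in> \<sigma>" "set_stab U \<in> F"
  shows "coll_stab \<sigma> \<in> F"
proof -
  define H where "H = coll_stab \<sigma>"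
  define K where "K = H \<inter> set_stab U"
  have U: "U \<subseteq> Y"
    using assms by blast
  have H: "subgroup H G"
    unfolding H_def by (rule coll_stab_subgroup) fact
  have K: "subgroup K G"
    unfolding K_def by (rule subgroups_Inter_pair) (use H set_stab_subgroup[OF U] in auto)
  then have KF: "K \<in> F"
    using assms(1,6) unfolding subgroup_family_def K_def by blast
  have Hc: "g \<in> carrier G" "translate (inv g) U \<in> \<sigma>" if "g \<in> H" for g
  proof -
    show "g \<in> carrier G" using that by (simp add: H_def)
    have "inv g \<in> H" using H that by (rule subgroup.m_inv_closed)
    then show "translate (inv g) U \<in> \<sigma>"
      using assms(5) by (auto simp: H_def)
  qed
  \<comment> \<open>right cosets of \<open>K\<close> correspond to values of \<open>g \<mapsto> (inv g) U\<close>, which lie in \<open>\<sigma>\<close>\<close>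
  let ?f = "\<lambda>V. {g \<in> H. translate (inv g) U = V}"
  have "rcosets\<^bsub>G\<lparr>carrier := H\<rparr>\<^esub> K \<subseteq> ?f ` \<sigma>"
  proof
    fix C assume "C \<in> rcosets\<^bsub>G\<lparr>carrier := H\<rparr>\<^esub> K"
    then obtain a where a: "a \<in> H" "C = (\<Union>k\<in>K. {k \<otimes> a})"
      by (auto simp: RCOSETS_def r_coset_def)
    have "C = ?f (translate (inv a) U)"
    proof (intro equalityI subsetI)
      fix g assume "g \<in> C"
      then obtain k where k: "k \<in> K" "g = k \<otimes> a"
        using a by auto
      then have kc: "k \<in> carrier G" "k \<in> H" "translate k U = U"
        by (auto simp: K_def)
      have "translate (inv k) U = U"
        using translate_inv_cancel[OF kc(1) U] kc(3) by simp
      then have "translate (inv g) U = translate (inv a) U"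
        using k(2) kc(1) Hc(1)[OF a(1)] U by (simp add: inv_mult_group translate_mult)
      then show "g \<in> ?f (translate (inv a) U)"
        using subgroup.m_closed[OF H kc(2) a(1)] k(2) by simp
    next
      fix g assume "g \<in> ?f (translate (inv a) U)"
      then have g: "g \<in> H" "translate (inv g) U = translate (inv a) U"
        by auto
      define k where "k = g \<otimes> inv a"
      have gk: "g = k \<otimes> a"
        using Hc(1)[OF g(1)] Hc(1)[OF a(1)] by (simp add: k_def m_assoc)
      have "k \<in> H"
        unfolding k_def using H g(1) a(1) by (intro subgroup.m_closed subgroup.m_inv_closed)
      moreover have "translate k U = U"
        using Hc(1)[OF g(1)] Hc(1)[OF a(1)] U g(2) translate_cancel_inv[of g U]
        by (simp add: k_def translate_mult)
      ultimately have "k \<in> K"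
        using Hc(1) by (simp add: K_def)
      then show "g \<in> C"
        using a(2) gk by blast
    qed
    then show "C \<in> ?f ` \<sigma>"
      using Hc(2)[OF a(1)] by blast
  qed
  then have "finite (rcosets\<^bsub>G\<lparr>carrier := H\<rparr>\<^esub> K)"
    using assms(4) finite_subset by blast
  then show ?thesis
    using assms(2) KF H unfolding virtually_closed_def H_def[symmetric] K_def by blast
qed

end


section \<open>A gap between finitely many numbers\<close>

text \<open>The \<open>n + 1\<close> intervals \<open>(k r, (k + 1) r]\<close> for \<open>k \<le> n\<close> lie below the value \<open>f m\<close>, so the at most \<open>n\<close>
  other positive values miss one of them; \<open>\<sigma>\<close> collects the values above that interval.\<close>

lemma exists_gap:
  fixes f :: "'u \<Rightarrow> real"
  assumes fin: "finite {u. 0 < f u}" and card: "card {u. 0 < f u} \<le> n + 1"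
    and r: "0 < r" and m: "real (n + 1) * r < f m"
  obtains \<sigma> where "\<sigma> \<noteq> {}" "finite \<sigma>" "card \<sigma> \<le> n + 1"
    and "\<And>u. u \<in> \<sigma> \<Longrightarrow> r < f u"
    and "\<And>u v. u \<in> \<sigma> \<Longrightarrow> v \<notin> \<sigma> \<Longrightarrow> r < f u - f v"
proof -
  have "\<exists>k\<le>n. \<forall>u. \<not> (real k * r < f u \<and> f u \<le> real (k + 1) * r)"
  proof (rule ccontr)
    assume "\<not> ?thesis"
    then obtain u where u: "\<And>k. k \<le> n \<Longrightarrow> real k * r < f (u k) \<and> f (u k) \<le> real (k + 1) * r"
      by metis
    have less: "f (u j) < f (u k)" if "j < k" "k \<le> n" for j k
    proof -
      have "real (j + 1) * r \<le> real k * r"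
        using that r by (intro mult_right_mono) auto
      then show ?thesis
        using u[of j] u[of k] that by linarith
    qed
    have "inj_on u {..n}"
      by (rule linorder_inj_onI') (use less in fastforce)
    moreover have "u k \<noteq> m" if "k \<le> n" for k
    proof -
      have "real (k + 1) * r \<le> real (n + 1) * r"
        using that r by (intro mult_right_mono) auto
      then show ?thesis
        using u[OF that] m by auto
    qed
    ultimately have "card (insert m (u ` {..n})) = n + 2"
      by (subst card_insert_disjoint) (auto simp: card_image)
    moreover have "insert m (u ` {..n}) \<subseteq> {u. 0 < f u}"
    proof -
      have "0 < f (u k)" if "k \<le> n" for k
        using u[OF that] r by (meson le_less_trans mult_nonneg_nonneg of_nat_0_le_iff less_imp_le)
      moreover have "0 < f m"
        using m r by (meson le_less_trans mult_nonneg_nonneg of_nat_0_le_iff less_imp_le)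
      ultimately show ?thesis
        by auto
    qed
    ultimately have "n + 2 \<le> card {u. 0 < f u}"
      using card_mono[OF fin, of "insert m (u ` {..n})"] by simp
    then show False
      using card by simp
  qed
  then obtain k where k: "k \<le> n" and gap: "\<And>u. real (k + 1) * r < f u \<or> f u \<le> real k * r"
    by (meson not_le)
  define \<sigma> where "\<sigma> = {u. real (k + 1) * r < f u}"
  have kr: "0 \<le> real k * r" "real (k + 1) * r = real k * r + r" "real (k + 1) * r \<le> real (n + 1) * r"
    using r k by (auto simp: algebra_simps)
  have sub: "\<sigma> \<subseteq> {u. 0 < f u}"
  proof
    fix u assume "u \<in> \<sigma>"
    then have "real (k + 1) * r < f u"
      by (simp only: \<sigma>_def mem_Collect_eq)
    then show "u \<in> {u. 0 < f u}"
      unfolding mem_Collect_eq using kr(1,2) r by linarith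
  qed
  show ?thesis
  proof (rule that[of \<sigma>])
    show "\<sigma> \<noteq> {}"
    proof -
      have "real (k + 1) * r < f m"
        using m kr(3) by linarith
      then show ?thesis
        unfolding \<sigma>_def by blast
    qed
    show "finite \<sigma>"
      by (rule finite_subset[OF sub fin])
    show "card \<sigma> \<le> n + 1"
      using card_mono[OF fin sub] card by linarith
    show "r < f u" if "u \<in> \<sigma>" for u
    proof -
      have "real (k + 1) * r < f u"
        using that by (simp only: \<sigma>_def mem_Collect_eq)
      then show ?thesis
        using kr(1,2) by linarith
    qed
    show "r < f u - f v" if "u \<in> \<sigma>" "v \<notin> \<sigma>" for u v
    proof -
      have "real (k + 1) * r < f u" "\<not> real (k + 1) * r < f v"
        using that by (simp_all only: \<sigma>_def mem_Collect_eq not_False_eq_True)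
      then show ?thesis
        using gap[of v] kr(2) by linarith
    qed
  qed
qed

section \<open>Equivariant weights from bump functions\<close>

lemma continuous_map_Max_insert:
  fixes f :: "'i \<Rightarrow> 'x \<Rightarrow> real"
  assumes "finite K" "\<And>i. i \<in> K \<Longrightarrow> continuous_map X euclideanreal (f i)"
  shows "continuous_map X euclideanreal (\<lambda>x. Max (insert c ((\<lambda>i. f i x) ` K)))"
  using assms
proof (induction K)
  case (insert i K)
  have "Max (insert c ((\<lambda>i. f i x) ` insert i K)) = max (f i x) (Max (insert c ((\<lambda>i. f i x) ` K)))" for x
    using insert.hyps(1) by (simp add: insert_commute[of c] del: Max_insert) (subst Max_insert, auto)
  then show ?case
    using insert by (simp add: continuous_map_real_max del: Max_insert)
qed simp

text \<open>Every point of \<open>X\<close> has a Urysohn function with value \<open>d\<close> there that is positive only in the slice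
  over \<open>\<one>\<close> of a member of the cover; by compactness, finitely many of them suffice for one to exceed
  \<open>d / 2\<close> at every point. Bumps are indexed by their peaks, so several may have the same member of the cover.\<close>

lemma (in fg_group_space) exists_bumps:
  assumes X: "compact_space X" "Hausdorff_space X"
    and op: "\<And>U. U \<in> \<I> \<Longrightarrow> openin (prod_space G X) U" and cov: "\<Union>\<I> = Y"
    and d: "0 < d"
  obtains A V and b :: "'x \<Rightarrow> 'x \<Rightarrow> real"
  where "finite A" and "\<And>a. a \<in> A \<Longrightarrow> V a \<in> \<I>"
    and "\<And>a. a \<in> A \<Longrightarrow> continuous_map X euclideanreal (b a)"
    and "\<And>a x. a \<in> A \<Longrightarrow> b a x \<le> d"
    and "\<And>a x. a \<in> A \<Longrightarrow> x \<in> topspace X \<Longrightarrow> 0 < b a x \<Longrightarrow> (\<one>, x) \<in> V a"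
    and "\<And>x. x \<in> topspace X \<Longrightarrow> \<exists>a\<in>A. d / 2 < b a x"
proof -
  have cr: "completely_regular_space X"
    by (meson X compact_Hausdorff_or_regular_imp_normal_space normal_imp_completely_regular_space)
  have "\<exists>U f. U \<in> \<I> \<and> continuous_map X euclideanreal f \<and> (\<forall>x. f x \<le> d) \<and>
      (\<forall>x\<in>topspace X. 0 < f x \<longrightarrow> (\<one>, x) \<in> U) \<and> d / 2 < f a" if a: "a \<in> topspace X" for a
  proof -
    obtain U where U: "U \<in> \<I>" "(\<one>, a) \<in> U"
      using cov a by (metis SigmaI UnionE one_closed)
    then have "openin X {x \<in> topspace X. (\<one>, x) \<in> U}"
      using op openin_prod_space_iff by blast
    then obtain f where f: "continuous_map X euclideanreal f" "f a = d"
        "f ` (topspace X - {x \<in> topspace X. (\<one>, x) \<in> U}) \<subseteq> {0}"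
      using cr U(2) a d unfolding completely_regular_space_gen_alt'[of d 0, OF less_imp_neq[OF d, symmetric]]
      by (metis (no_types, lifting) mem_Collect_eq)
    show ?thesis
    proof (intro exI conjI ballI impI allI)
      show "continuous_map X euclideanreal (\<lambda>x. min (f x) d)"
        using f(1) by (intro continuous_map_real_min) auto
      show "(\<one>, x) \<in> U" if "x \<in> topspace X" "0 < min (f x) d" for x
        using f(3) that by fastforce
    qed (use U f d in auto)
  qed
  then obtain V b where Vb: "\<And>a. a \<in> topspace X \<Longrightarrow> V a \<in> \<I> \<and> continuous_map X euclideanreal (b a)
      \<and> (\<forall>x. b a x \<le> d) \<and> (\<forall>x\<in>topspace X. 0 < b a x \<longrightarrow> (\<one>, x) \<in> V a) \<and> d / 2 < b a a"
    by metis
  let ?N = "\<lambda>a. {x \<in> topspace X. b a x \<in> {d / 2 <..}}"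
  have "openin X (?N a)" if "a \<in> topspace X" for a
    using Vb[OF that] by (intro openin_continuous_map_preimage) auto
  then have "\<forall>N\<in>?N ` topspace X. openin X N"
    by blast
  moreover have "topspace X \<subseteq> \<Union>(?N ` topspace X)"
    using Vb by auto
  ultimately obtain \<F> where "finite \<F>" "\<F> \<subseteq> ?N ` topspace X" "topspace X \<subseteq> \<Union>\<F>"
    using X(1) unfolding compact_space_alt by meson
  then obtain A where A: "finite A" "A \<subseteq> topspace X" "topspace X \<subseteq> \<Union>(?N ` A)"
    using finite_subset_image[of \<F> ?N "topspace X"] by blast
  show ?thesis
  proof (rule that[of A V b])
    show "\<exists>a\<in>A. d / 2 < b a x" if "x \<in> topspace X" for x
      using A(3) that by auto
  qed (use A Vb in blast)+
qed

text \<open>The bumps live on \<open>{\<one>} \<times> X\<close>, which meets every orbit of the diagonal action exactly once.\<close>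

locale bump_system = fg_group_space G S X \<phi>
  for G :: "('g, 'm) monoid_scheme" (structure) and S :: "'g set" and X :: "'x topology"
    and \<phi> :: "'g \<Rightarrow> 'x \<Rightarrow> 'x" +
  fixes d :: real and A :: "'x set" and V :: "'x \<Rightarrow> ('g \<times> 'x) set" and b :: "'x \<Rightarrow> 'x \<Rightarrow> real"
  assumes d_pos: "0 < d"
    and finite_bumps: "finite A"
    and support_closed: "a \<in> A \<Longrightarrow> V a \<subseteq> Y"
    and bump_continuous: "a \<in> A \<Longrightarrow> continuous_map X euclideanreal (b a)"
    and bump_le: "a \<in> A \<Longrightarrow> b a x \<le> d"
    and bump_support: "a \<in> A \<Longrightarrow> x \<in> topspace X \<Longrightarrow> 0 < b a x \<Longrightarrow> (\<one>, x) \<in> V a"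
    and bump_large: "x \<in> topspace X \<Longrightarrow> \<exists>a\<in>A. d / 2 < b a x"
begin

text \<open>The pairs \<open>(a, h)\<close> whose translated bump, with peak in \<open>{h} \<times> X\<close>, is assigned to \<open>U\<close>
  and can reach the slice \<open>{g} \<times> X\<close>.\<close>

definition indices :: "('g \<times> 'x) set \<Rightarrow> 'g \<Rightarrow> ('x \<times> 'g) set"
  where "indices U g = {(a, h) \<in> A \<times> gball g d. translate h (V a) = U}"

text \<open>The translate by \<open>h\<close> of the bump at \<open>a\<close> has height \<open>b a (\<phi> (inv h) x)\<close> at \<open>(h, x)\<close> and
  decreases with slope one away from \<open>h\<close>. As heights are at most \<open>d\<close>, it is not positive outside the ball of
  radius \<open>d\<close>, so that restricting to that ball loses nothing and makes the maximum a finite one.\<close>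

definition weight :: "('g \<times> 'x) set \<Rightarrow> 'g \<Rightarrow> 'x \<Rightarrow> real"
  where "weight U g x =
    Max (insert 0 ((\<lambda>i. b (fst i) (\<phi> (inv (snd i)) x) - gdist g (snd i)) ` indices U g))"

lemma finite_indices: "g \<in> carrier G \<Longrightarrow> finite (indices U g)"
  using finite_bumps finite_gball[of g d]
  by (intro finite_subset[of "indices U g" "A \<times> gball g d"]) (auto simp: indices_def)

lemma mem_indices: "(a, h) \<in> indices U g \<longleftrightarrow> a \<in> A \<and> h \<in> gball g d \<and> translate h (V a) = U"
  by (simp add: indices_def)

lemma weight_ge:
  "g \<in> carrier G \<Longrightarrow> (a, h) \<in> indices U g \<Longrightarrow> b a (\<phi> (inv h) x) - gdist g h \<le> weight U g x"
  unfolding weight_def using finite_indices by (intro Max_ge) force+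

lemma weight_nonneg: "g \<in> carrier G \<Longrightarrow> 0 \<le> weight U g x"
  unfolding weight_def using finite_indices by (intro Max_ge) auto

lemma weight_le:
  assumes "g \<in> carrier G" "0 \<le> c"
    and "\<And>a h. (a, h) \<in> indices U g \<Longrightarrow> b a (\<phi> (inv h) x) - gdist g h \<le> c"
  shows "weight U g x \<le> c"
  unfolding weight_def using assms finite_indices by (intro Max.boundedI) auto

lemma weight_posD:
  assumes "g \<in> carrier G" "0 < weight U g x"
  obtains a h where "(a, h) \<in> indices U g" "gdist g h < b a (\<phi> (inv h) x)"
proof -
  have "\<exists>a h. (a, h) \<in> indices U g \<and> gdist g h < b a (\<phi> (inv h) x)"
  proof (rule ccontr)
    assume "\<not> ?thesis"
    then have "weight U g x \<le> 0"
      using assms(1) by (intro weight_le) (auto simp: not_less)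
    then show False
      using assms(2) by simp
  qed
  then show ?thesis
    using that by blast
qed

lemma weight_support:
  assumes g: "g \<in> carrier G" and x: "x \<in> topspace X" and pos: "0 < weight U g x"
  shows "U \<subseteq> Y" and "\<exists>a\<in>A. \<exists>h\<in>gball g d. U = translate h (V a)"
    and "gball g d \<times> {x} \<inter> U \<noteq> {}"
proof -
  obtain a h where ah: "(a, h) \<in> indices U g" "gdist g h < b a (\<phi> (inv h) x)"
    using weight_posD[OF g pos] by blast
  then have a: "a \<in> A" and h: "h \<in> carrier G" "h \<in> gball g d" and U: "U = translate h (V a)"
    using gball_closed by (auto simp: mem_indices)
  show "U \<subseteq> Y"
    using translate_closed[OF h(1) support_closed[OF a]] U by simp
  show "\<exists>a\<in>A. \<exists>h\<in>gball g d. U = translate h (V a)"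
    using a h U by blast
  have "0 < b a (\<phi> (inv h) x)"
    using ah(2) gdist_nonneg[of g h] by linarith
  then have "(\<one>, \<phi> (inv h) x) \<in> V a"
    using bump_support[OF a] action_closed h(1) x by simp
  then have "(h, x) \<in> U"
    using h(1) x unfolding U by (simp add: mem_translate support_closed[OF a])
  then show "gball g d \<times> {x} \<inter> U \<noteq> {}"
    using h(2) by blast
qed

lemma weight_large:
  assumes g: "g \<in> carrier G" and x: "x \<in> topspace X"
  shows "\<exists>U. d / 2 < weight U g x"
proof -
  obtain a where a: "a \<in> A" "d / 2 < b a (\<phi> (inv g) x)"
    using bump_large[of "\<phi> (inv g) x"] action_closed g x by auto
  then have "(a, g) \<in> indices (translate g (V a)) g"
    using center_in_gball[OF g] d_pos by (simp add: mem_indices)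
  then have "d / 2 < weight (translate g (V a)) g x"
    using weight_ge[OF g, of a g _ x] gdist_self[OF g] a(2) by fastforce
  then show ?thesis ..
qed

lemma weight_lipschitz:
  assumes g: "g \<in> carrier G" and k: "k \<in> carrier G"
  shows "weight U g x \<le> weight U k x + gdist g k"
proof (rule weight_le[OF g])
  show "0 \<le> weight U k x + gdist g k"
    using weight_nonneg[OF k] gdist_nonneg by (simp add: add_nonneg_nonneg)
  fix a h assume ah: "(a, h) \<in> indices U g"
  then have a: "a \<in> A" and h: "h \<in> carrier G"
    using gball_closed by (auto simp: mem_indices)
  have tri: "gdist k h \<le> gdist g k + gdist g h"
    using gdist_triangle[OF k g h] gdist_sym[OF k g] by simp
  show "b a (\<phi> (inv h) x) - gdist g h \<le> weight U k x + gdist g k"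
  \<comment> \<open>if \<open>h\<close> is out of reach from \<open>k\<close>, then \<open>d - gdist g h < gdist g k\<close>\<close>
  proof (cases "h \<in> gball k d")
    case True
    then have "(a, h) \<in> indices U k"
      using ah by (simp add: mem_indices)
    then show ?thesis
      using weight_ge[OF k, of a h U x] tri by linarith
  next
    case False
    then have "d < gdist k h"
      using h by (simp add: gball_iff)
    then show ?thesis
      using bump_le[OF a, of "\<phi> (inv h) x"] tri weight_nonneg[OF k, of U x] by linarith
  qed
qed

text \<open>Translation by \<open>k\<close> matches the pair \<open>(a, (inv k) h)\<close> for \<open>U\<close> with the pair \<open>(a, h)\<close> for \<open>kU\<close>.\<close>

lemma weight_translate_le:
  assumes k: "k \<in> carrier G" and U: "U \<subseteq> Y" and g: "g \<in> carrier G" and x: "x \<in> topspace X"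
  shows "weight (translate k U) (k \<otimes> g) (\<phi> k x) \<le> weight U g x"
proof (rule weight_le)
  fix a h assume "(a, h) \<in> indices (translate k U) (k \<otimes> g)"
  then have a: "a \<in> A" and h: "h \<in> carrier G" "h \<in> gball (k \<otimes> g) d" and t: "translate h (V a) = translate k U"
    using gball_closed by (auto simp: mem_indices)
  let ?h = "inv k \<otimes> h"
  have kh: "k \<otimes> ?h = h" "?h \<in> carrier G"
    using k h by (auto simp: mult_inv_cancel)
  have "translate ?h (V a) = U"
    using k h U t by (simp add: translate_mult support_closed[OF a] translate_inv_cancel)
  moreover have "?h \<in> gball g d"
    using gball_translate[OF k g kh(2)] kh h by simp
  ultimately have "(a, ?h) \<in> indices U g"
    using a by (simp add: mem_indices)
  moreover have "\<phi> (inv ?h) x = \<phi> (inv h) (\<phi> k x)"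
    using k h x by (simp add: inv_mult_group action_mult)
  moreover have "gdist (k \<otimes> g) h = gdist g ?h"
    using gdist_translate[OF k g kh(2)] kh by simp
  ultimately show "b a (\<phi> (inv h) (\<phi> k x)) - gdist (k \<otimes> g) h \<le> weight U g x"
    using weight_ge[OF g, of a ?h U x] by simp
qed (use k g weight_nonneg in auto)

lemma weight_translate:
  assumes k: "k \<in> carrier G" and U: "U \<subseteq> Y" and g: "g \<in> carrier G" and x: "x \<in> topspace X"
  shows "weight (translate k U) (k \<otimes> g) (\<phi> k x) = weight U g x"
proof (rule antisym[OF weight_translate_le[OF assms]])
  show "weight U g x \<le> weight (translate k U) (k \<otimes> g) (\<phi> k x)"
    using weight_translate_le[of "inv k" "translate k U" "k \<otimes> g" "\<phi> k x"] assms
    by (simp add: translate_closed action_closed translate_inv_cancel inv_mult_cancel action_inv_cancel)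
qed

lemma weight_continuous:
  assumes g: "g \<in> carrier G"
  shows "continuous_map X euclideanreal (weight U g)"
proof -
  have "continuous_map X euclideanreal (\<lambda>x. b a (\<phi> (inv h) x) - gdist g h)" if "(a, h) \<in> indices U g" for a h
  proof -
    have "a \<in> A" "h \<in> carrier G"
      using that gball_closed by (auto simp: mem_indices)
    then have "continuous_map X euclideanreal (b a \<circ> \<phi> (inv h))"
      by (intro continuous_map_compose[OF action_continuous bump_continuous]) auto
    then show ?thesis
      by (intro continuous_map_diff) (auto simp: o_def)
  qed
  then show ?thesis
    unfolding weight_def[abs_def] using finite_indices[OF g] by (intro continuous_map_Max_insert) auto
qed

section \<open>Pieces of the product\<close>

text \<open>The bound \<open>r < weight U g x\<close> forces the members of \<open>\<sigma>\<close>, when the piece is nonempty, to be translates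
  of the finitely many supports and to be met by a common ball of radius \<open>d\<close>.\<close>

definition piece :: "real \<Rightarrow> ('g \<times> 'x) set set \<Rightarrow> ('g \<times> 'x) set"
  where "piece r \<sigma> = {(g, x) \<in> Y. \<forall>U\<in>\<sigma>. r < weight U g x \<and>
    (\<forall>W\<in>Pow Y - \<sigma>. r < weight U g x - weight W g x)}"

lemma mem_piece: "(g, x) \<in> piece r \<sigma> \<longleftrightarrow> (g, x) \<in> Y \<and> (\<forall>U\<in>\<sigma>. r < weight U g x \<and>
    (\<forall>W\<in>Pow Y - \<sigma>. r < weight U g x - weight W g x))"
  by (simp add: piece_def)

lemma piece_closed: "piece r \<sigma> \<subseteq> Y"
  by (auto simp: piece_def)

lemma mem_pieceD:
  assumes "0 < r" "(g, x) \<in> piece r \<sigma>" "U \<in> \<sigma>"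
  shows "U \<subseteq> Y" and "\<exists>a\<in>A. \<exists>h\<in>carrier G. U = translate h (V a)"
    and "gball g d \<times> {x} \<inter> U \<noteq> {}"
proof -
  have gx: "g \<in> carrier G" "x \<in> topspace X" "0 < weight U g x"
    using assms by (force simp: mem_piece)+
  show "U \<subseteq> Y" "gball g d \<times> {x} \<inter> U \<noteq> {}"
    by (rule weight_support[OF gx])+
  show "\<exists>a\<in>A. \<exists>h\<in>carrier G. U = translate h (V a)"
    using weight_support(2)[OF gx] gball_closed by blast
qed

lemma translate_piece_subset:
  assumes k: "k \<in> carrier G" and \<sigma>: "\<sigma> \<subseteq> Pow Y"
  shows "translate k (piece r \<sigma>) \<subseteq> piece r (translates k \<sigma>)"
proof (rule subrelI)
  fix g x assume "(g, x) \<in> translate k (piece r \<sigma>)"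
  then have gx: "g \<in> carrier G" "x \<in> topspace X"
    and p: "(inv k \<otimes> g, \<phi> (inv k) x) \<in> piece r \<sigma>"
    using mem_translate[OF k piece_closed] by auto
  have w: "weight (translate k U) g x = weight U (inv k \<otimes> g) (\<phi> (inv k) x)" if "U \<subseteq> Y" for U
    using weight_translate[OF k that, of "inv k \<otimes> g" "\<phi> (inv k) x"] k gx
    by (simp add: mult_inv_cancel action_closed action_cancel_inv)
  have "r < weight (translate k U) g x \<and>
      (\<forall>W\<in>Pow Y - translates k \<sigma>. r < weight (translate k U) g x - weight W g x)" if U: "U \<in> \<sigma>" for U
  proof (intro conjI ballI)
    show "r < weight (translate k U) g x"
      using p U w[of U] \<sigma> by (auto simp: mem_piece)
    fix W assume W: "W \<in> Pow Y - translates k \<sigma>"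
    let ?W = "translate (inv k) W"
    have W': "translate k ?W = W" "?W \<subseteq> Y"
      using W k translate_cancel_inv[OF k, of W] translate_closed[of "inv k" W] by auto
    then have "?W \<notin> \<sigma>"
      using W by (metis DiffD2 image_eqI)
    then have "r < weight U (inv k \<otimes> g) (\<phi> (inv k) x) - weight ?W (inv k \<otimes> g) (\<phi> (inv k) x)"
      using p U W'(2) unfolding mem_piece by blast
    then show "r < weight (translate k U) g x - weight W g x"
      using w[of U] w[OF W'(2)] W'(1) U \<sigma> by auto
  qed
  then show "(g, x) \<in> piece r (translates k \<sigma>)"
    using gx unfolding mem_piece by blast
qed

lemma translate_piece:
  assumes k: "k \<in> carrier G" and \<sigma>: "\<sigma> \<subseteq> Pow Y"
  shows "translate k (piece r \<sigma>) = piece r (translates k \<sigma>)"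
proof (rule antisym[OF translate_piece_subset[OF assms]])
  have k\<sigma>: "translates k \<sigma> \<subseteq> Pow Y"
    using \<sigma> translate_closed[OF k] by blast
  have "translates (inv k) (translates k \<sigma>) = \<sigma>"
    using translates_mult[of "inv k" k \<sigma>] translates_one[OF \<sigma>] k \<sigma> by simp
  then have "translate (inv k) (piece r (translates k \<sigma>)) \<subseteq> piece r \<sigma>"
    using translate_piece_subset[of "inv k" "translates k \<sigma>" r] k k\<sigma> by simp
  then have "translate k (translate (inv k) (piece r (translates k \<sigma>))) \<subseteq> translate k (piece r \<sigma>)"
    by (rule image_mono)
  then show "piece r (translates k \<sigma>) \<subseteq> translate k (piece r \<sigma>)"
    using translate_cancel_inv[OF k piece_closed] by simp
qed

text \<open>On a slice \<open>{g} \<times> X\<close> only the finitely many sets in \<open>M\<close> outside \<open>\<sigma>\<close> can have positive weight, so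
  the infinitely many conditions in the definition reduce to finitely many.\<close>

lemma openin_piece:
  assumes r: "0 < r" and \<sigma>: "finite \<sigma>"
  shows "openin (prod_space G X) (piece r \<sigma>)"
proof -
  have "openin X {x \<in> topspace X. (g, x) \<in> piece r \<sigma>}" if g: "g \<in> carrier G" for g
  proof -
    define M where "M = (\<lambda>(a, h). translate h (V a)) ` (A \<times> gball g d) \<inter> Pow Y - \<sigma>"
    have M: "finite M"
      unfolding M_def using finite_bumps finite_gball[OF g, of d] by auto
    have zero: "weight W g x = 0" if "x \<in> topspace X" "W \<in> Pow Y - \<sigma>" "W \<notin> M" for W x
    proof (rule ccontr)
      assume "weight W g x \<noteq> 0"
      then have "0 < weight W g x"
        using weight_nonneg[OF g, of W x] by simp
      then show False
        using weight_support(2)[OF g that(1)] that(2,3) by (auto simp: M_def)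
    qed
    have "{x \<in> topspace X. (g, x) \<in> piece r \<sigma>} = (\<Inter>U\<in>\<sigma>. {x \<in> topspace X. weight U g x \<in> {r<..}} \<inter>
        ((\<Inter>W\<in>M. {x \<in> topspace X. weight U g x - weight W g x \<in> {r<..}}) \<inter> topspace X)) \<inter> topspace X"
      (is "?L = ?R")
    proof (intro equalityI subsetI)
      fix x assume "x \<in> ?L"
      then show "x \<in> ?R"
        by (auto simp: mem_piece M_def)
    next
      fix x assume x: "x \<in> ?R"
      have "r < weight U g x - weight W g x" if "U \<in> \<sigma>" "W \<in> Pow Y - \<sigma>" for U W
        using x that zero[of x W] by (cases "W \<in> M") auto
      then show "x \<in> ?L"
        using x g unfolding mem_piece by auto
    qed
    also have "openin X \<dots>"
      using \<sigma> M
      by (intro openin_INT openin_Int openin_continuous_map_preimage[of X euclideanreal]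
          continuous_map_diff weight_continuous g) auto
    finally show ?thesis .
  qed
  then show ?thesis
    using piece_closed by (simp add: openin_prod_space_iff)
qed

text \<open>Some \<open>U\<close> in \<open>\<sigma>\<close> is not in \<open>\<tau>\<close> and some \<open>W\<close> in \<open>\<tau>\<close> is not in \<open>\<sigma>\<close>. From one piece to the other the
  difference of their weights changes by more than \<open>2 r\<close>, and each weight is 1-Lipschitz.\<close>

lemma pieces_apart:
  assumes "0 < r" "finite \<sigma>" "finite \<tau>" "card \<sigma> = card \<tau>" "\<sigma> \<noteq> \<tau>"
    and g: "(g, x) \<in> piece r \<sigma>" and h: "(h, x) \<in> piece r \<tau>"
  shows "r < gdist g h"
proof -
  obtain U where U: "U \<in> \<sigma>" "U \<notin> \<tau>"
    using assms(2-5) card_subset_eq[of \<tau> \<sigma>] by auto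
  obtain W where W: "W \<in> \<tau>" "W \<notin> \<sigma>"
    using assms(2-5) card_subset_eq[of \<sigma> \<tau>] by auto
  have UW: "U \<subseteq> Y" "W \<subseteq> Y"
    using mem_pieceD(1)[OF assms(1)] g h U W by blast+
  have gh: "g \<in> carrier G" "h \<in> carrier G"
    using g h by (auto simp: mem_piece)
  have "r < weight U g x - weight W g x"
    using g U W UW by (simp add: mem_piece)
  moreover have "r < weight W h x - weight U h x"
    using h U W UW by (simp add: mem_piece)
  ultimately show ?thesis
    using weight_lipschitz[OF gh, of U x] weight_lipschitz[OF gh(2,1), of W x] gdist_sym[OF gh]
    by linarith
qed

lemma mem_some_piece:
  assumes r: "0 < r" and d: "2 * real (n + 1) * r \<le> d" and g: "g \<in> carrier G" and x: "x \<in> topspace X"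
    and fin: "finite {U. 0 < weight U g x}" and card: "card {U. 0 < weight U g x} \<le> n + 1"
  obtains \<sigma> where "finite \<sigma>" "\<sigma> \<noteq> {}" "card \<sigma> \<le> n + 1" "(g, x) \<in> piece r \<sigma>"
proof -
  obtain U where "d / 2 < weight U g x"
    using weight_large[OF g x] by blast
  moreover have "2 * real (n + 1) * r = 2 * (real (n + 1) * r)"
    by simp
  ultimately have U: "real (n + 1) * r < weight U g x"
    using d by linarith
  show ?thesis
  proof (rule exists_gap[OF fin card r U])
    fix \<sigma> assume "\<sigma> \<noteq> {}" "finite \<sigma>" "card \<sigma> \<le> n + 1"
      and "\<And>u. u \<in> \<sigma> \<Longrightarrow> r < weight u g x"
      and "\<And>u v. u \<in> \<sigma> \<Longrightarrow> v \<notin> \<sigma> \<Longrightarrow> r < weight u g x - weight v g x"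
    then show thesis
      using that[of \<sigma>] g x by (auto simp: mem_piece)
  qed
qed

end

text \<open>The pieces of sets of size \<open>i + 1\<close> form the \<open>i\<close>-th family. A translate of a piece is the piece of
  the translated set, which has the same size, so it is far from the original unless the set is
  preserved; hence a nonempty piece has the stabiliser of its set \<open>\<sigma>\<close>. The members of \<open>\<sigma>\<close> are all met
  by one ball of radius \<open>d\<close>, which is why the hypothesis on stabilisers only concerns such \<open>\<sigma>\<close>.\<close>

theorem (in fg_group_space) disjoint_families_from_multiplicity:
  assumes X: "compact_space X" "Hausdorff_space X" and r: "0 < r"
    and d: "d = 2 * real (n + 1) * r"
    and \<I>: "open_F_cover G (prod_space G X) (diag_action G X \<phi>) F \<I>"
    and mult: "G_multiplicity_le G S X d \<I> (n + 1)"
    and stab: "\<And>\<sigma> g x. finite \<sigma> \<Longrightarrow> \<sigma> \<noteq> {} \<Longrightarrow> \<sigma> \<subseteq> \<I> \<Longrightarrow> (g, x) \<in> Y \<Longrightarrow>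
        (\<And>U. U \<in> \<sigma> \<Longrightarrow> gball g d \<times> {x} \<inter> U \<noteq> {}) \<Longrightarrow> coll_stab \<sigma> \<in> F"
  shows "\<exists>\<J> :: nat \<Rightarrow> ('g \<times> 'x) set set.
    (\<forall>i\<le>n. F_fam G Y (diag_action G X \<phi>) F (\<J> i) \<and> G_disjoint G S r (\<J> i)) \<and>
    open_cover (prod_space G X) (\<Union>i\<le>n. \<J> i)"
proof -
  have fam: "F_fam G Y (diag_action G X \<phi>) F \<I>" and op: "\<And>U. U \<in> \<I> \<Longrightarrow> openin (prod_space G X) U"
    and cov: "\<Union>\<I> = Y"
    using \<I> by (auto simp: open_F_cover_iff)
  have d_pos: "0 < d"
    using r d by simp
  obtain A V and b :: "'x \<Rightarrow> 'x \<Rightarrow> real" where bumps: "finite A"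
      "\<And>a. a \<in> A \<Longrightarrow> V a \<in> \<I>" "\<And>a. a \<in> A \<Longrightarrow> continuous_map X euclideanreal (b a)"
      "\<And>a x. a \<in> A \<Longrightarrow> b a x \<le> d"
      "\<And>a x. a \<in> A \<Longrightarrow> x \<in> topspace X \<Longrightarrow> 0 < b a x \<Longrightarrow> (\<one>, x) \<in> V a"
      "\<And>x. x \<in> topspace X \<Longrightarrow> \<exists>a\<in>A. d / 2 < b a x"
    by (rule exists_bumps[OF X op cov d_pos], assumption) (rule that)
  interpret bump_system G S X \<phi> d A V b
    by unfold_locales (use bumps d_pos F_famD(1)[OF fam] in auto)
  have in_cover: "U \<in> \<I>" if "(g, x) \<in> piece r \<sigma>" "U \<in> \<sigma>" for g x \<sigma> U
    using mem_pieceD(2)[OF r that] F_famD(4)[OF fam bumps(2)] by auto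
  define \<J> where "\<J> i = {piece r \<sigma> |\<sigma>. finite \<sigma> \<and> card \<sigma> = i + 1 \<and> piece r \<sigma> \<noteq> {}}" for i
  have collE: thesis if P: "P \<in> \<J> i"
    and elim: "\<And>\<sigma>. P = piece r \<sigma> \<Longrightarrow> finite \<sigma> \<Longrightarrow> card \<sigma> = i + 1 \<Longrightarrow> P \<noteq> {} \<Longrightarrow> \<sigma> \<subseteq> \<I> \<Longrightarrow> \<sigma> \<subseteq> Pow Y \<Longrightarrow> thesis"
    for P i thesis
  proof -
    obtain \<sigma> where \<sigma>: "P = piece r \<sigma>" "finite \<sigma>" "card \<sigma> = i + 1" "P \<noteq> {}"
      using P by (auto simp: \<J>_def)
    then obtain g x where "(g, x) \<in> piece r \<sigma>"
      by fastforce
    then have "\<sigma> \<subseteq> \<I>"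
      using in_cover by blast
    then show thesis
      using elim[OF \<sigma>] F_famD(1)[OF fam] by blast
  qed
  have F: "F_fam G Y (diag_action G X \<phi>) F (\<J> i)" for i
  proof (rule F_famI)
    fix P assume "P \<in> \<J> i"
    then obtain \<sigma> where P: "P = piece r \<sigma>" and \<sigma>: "finite \<sigma>" "card \<sigma> = i + 1" "\<sigma> \<subseteq> \<I>" "\<sigma> \<subseteq> Pow Y"
      and ne: "P \<noteq> {}"
      by (rule collE)
    show "P \<subseteq> Y"
      using piece_closed P by simp
    have card: "finite (translates g \<sigma>)" "card (translates g \<sigma>) = i + 1" if g: "g \<in> carrier G" for g
    proof -
      have "inj_on (translate g) \<sigma>"
        using translate_inv_cancel[OF g] \<sigma>(4) by (metis PowD inj_on_inverseI subsetD)
      then show "finite (translates g \<sigma>)" "card (translates g \<sigma>) = i + 1"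
        using \<sigma> by (simp_all add: card_image)
    qed
    have tr: "translate g P = piece r (translates g \<sigma>)" if "g \<in> carrier G" for g
      using translate_piece[OF that \<sigma>(4)] P by simp
    have fix\<sigma>: "translates g \<sigma> = \<sigma>" if g: "g \<in> carrier G" and m: "translate g P \<inter> P \<noteq> {}" for g
    proof (rule ccontr)
      assume neq: "translates g \<sigma> \<noteq> \<sigma>"
      obtain h x where "(h, x) \<in> piece r (translates g \<sigma>)" "(h, x) \<in> piece r \<sigma>"
        using m tr[OF g] P by auto
      moreover have "h \<in> carrier G"
        using calculation by (simp add: mem_piece)
      ultimately show False
        using pieces_apart[OF r card(1)[OF g] \<sigma>(1) _ neq, of h x h] card(2)[OF g] \<sigma>(2) gdist_self r
        by simp
    qed
    have "translate g P = P \<longleftrightarrow> translates g \<sigma> = \<sigma>" if "g \<in> carrier G" for g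
      using fix\<sigma>[OF that] tr[OF that] P ne by (metis Int_absorb)
    then have "set_stab P = coll_stab \<sigma>"
      by blast
    moreover have "coll_stab \<sigma> \<in> F"
    proof -
      obtain g x where gx: "(g, x) \<in> piece r \<sigma>"
        using ne P by auto
      have "\<sigma> \<noteq> {}"
        using \<sigma>(2) by auto
      moreover have "(g, x) \<in> Y"
        using gx piece_closed by blast
      ultimately show ?thesis
        using stab[OF \<sigma>(1) _ \<sigma>(3)] mem_pieceD(3)[OF r gx] by blast
    qed
    ultimately show "set_stab P \<in> F"
      by simp
    fix g assume g: "g \<in> carrier G"
    show "translate g P = P" if "translate g P \<inter> P \<noteq> {}"
      using fix\<sigma>[OF g that] tr[OF g] P by simp
    show "translate g P \<in> \<J> i"
      using tr[OF g] card[OF g] ne by (auto simp: \<J>_def)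
  qed
  have disj: "G_disjoint G S r (\<J> i)" for i
    unfolding G_disjoint_def
  proof (rule pairwiseI)
    fix P Q assume PQ: "P \<in> \<J> i" "Q \<in> \<J> i" "P \<noteq> Q"
    obtain \<sigma> where \<sigma>: "P = piece r \<sigma>" "finite \<sigma>" "card \<sigma> = i + 1"
      using PQ(1) by (rule collE)
    obtain \<tau> where \<tau>: "Q = piece r \<tau>" "finite \<tau>" "card \<tau> = i + 1"
      using PQ(2) by (rule collE)
    show "nbhd P r \<inter> Q = {}"
    proof (rule ccontr)
      assume "nbhd P r \<inter> Q \<noteq> {}"
      then obtain g h x where "(g, x) \<in> P" "h \<in> gball g r" "(h, x) \<in> Q"
        by (auto simp: G_nbhd_def)
      then show False
        using pieces_apart[OF r \<sigma>(2) \<tau>(2), of g x h] \<sigma> \<tau> PQ(3) by (auto simp: gball_iff)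
    qed
  qed
  have "openin (prod_space G X) P" if "P \<in> \<J> i" for P i
    using that openin_piece[OF r] by (auto simp: \<J>_def)
  moreover have "\<Union>(\<Union>i\<le>n. \<J> i) = Y"
  proof
    show "\<Union>(\<Union>i\<le>n. \<J> i) \<subseteq> Y"
      using piece_closed by (auto simp: \<J>_def)
    show "Y \<subseteq> \<Union>(\<Union>i\<le>n. \<J> i)"
    proof clarify
      fix g x assume gx: "g \<in> carrier G" "x \<in> topspace X"
      let ?M = "{U \<in> \<I>. gball g d \<times> {x} \<inter> U \<noteq> {}}"
      have M: "finite ?M" "card ?M \<le> n + 1"
        using mult gx unfolding G_multiplicity_le_def ecard_le_iff by blast+
      have sub: "{U. 0 < weight U g x} \<subseteq> ?M"
      proof
        fix U assume "U \<in> {U. 0 < weight U g x}"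
        then have pos: "0 < weight U g x"
          by simp
        obtain a h where "a \<in> A" "h \<in> carrier G" "U = translate h (V a)"
          using weight_support(2)[OF gx pos] gball_closed by blast
        then show "U \<in> ?M"
          using F_famD(4)[OF fam bumps(2)] weight_support(3)[OF gx pos] by simp
      qed
      have "2 * real (n + 1) * r \<le> d"
        using d by simp
      then obtain \<sigma> where \<sigma>: "finite \<sigma>" "\<sigma> \<noteq> {}" "card \<sigma> \<le> n + 1" "(g, x) \<in> piece r \<sigma>"
        by (rule mem_some_piece[OF r _ gx finite_subset[OF sub M(1)]
            order_trans[OF card_mono[OF M(1) sub] M(2)]])
      have "0 < card \<sigma>"
        using \<sigma>(1,2) by (simp add: card_gt_0_iff)
      then obtain i where i: "card \<sigma> = i + 1" "i \<le> n"
        using \<sigma>(3) by (cases "card \<sigma>") auto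
      then have "piece r \<sigma> \<in> \<J> i"
        using \<sigma>(1,4) unfolding \<J>_def by blast
      then show "(g, x) \<in> \<Union>(\<Union>i\<le>n. \<J> i)"
        using \<sigma>(4) i(2) by blast
    qed
  qed
  ultimately have "open_cover (prod_space G X) (\<Union>i\<le>n. \<J> i)"
    by (auto simp: open_cover_def topspace_prod_space)
  then show ?thesis
    using F disj by blast
qed


section \<open>The three characterisations\<close>

theorem proposition2p8:
  fixes G :: "('g, 'm) monoid_scheme" and S :: "'g set" and F :: "'g set set"
    and n :: nat and X :: "'x topology" and \<phi> :: "'g \<Rightarrow> 'x \<Rightarrow> 'x"
  assumes "group G"
    and "finite S" and "S \<subseteq> carrier G" and "generate G S = carrier G"
    and "subgroup_family G F"
    and "compact_space X" and "Hausdorff_space X" and "G_space G X \<phi>"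
  shows
    "let Y = prod_space G X;
         \<psi> = diag_action G X \<phi>;
         cond1 = (eq_asdim G S F X \<phi> \<le> ereal (real n));
         cond2 = (\<forall>r>0. \<exists>\<I> :: nat \<Rightarrow> ('g \<times> 'x) set set.
                    (\<forall>i\<le>n. F_fam G (topspace Y) \<psi> F (\<I> i) \<and> G_disjoint G S r (\<I> i)) \<and>
                    open_cover Y (\<Union>i\<le>n. \<I> i));
         cond3 = (\<forall>d\<ge>0. \<exists>\<I>. open_F_cover G Y \<psi> F \<I> \<and> G_multiplicity_le G S X d \<I> (n + 1))
     in (cond1 \<longleftrightarrow> cond2) \<and> (cond1 \<longrightarrow> cond3) \<and>
        (virtually_closed G F \<longrightarrow> (cond1 \<longleftrightarrow> cond2) \<and> (cond2 \<longleftrightarrow> cond3))"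
proof -
  interpret fg_group_space G S X \<phi>
    by (rule fg_group_space.intro[OF assms(1) fg_group_space_axioms.intro[OF assms(2-4,8)]])
  let ?Y = "prod_space G X" and ?\<psi> = "diag_action G X \<phi>"
  define cond1 where "cond1 \<longleftrightarrow> eq_asdim G S F X \<phi> \<le> ereal (real n)"
  define cond2 where "cond2 \<longleftrightarrow> (\<forall>r>0. \<exists>\<I> :: nat \<Rightarrow> ('g \<times> 'x) set set.
      (\<forall>i\<le>n. F_fam G (topspace ?Y) ?\<psi> F (\<I> i) \<and> G_disjoint G S r (\<I> i)) \<and>
      open_cover ?Y (\<Union>i\<le>n. \<I> i))"
  define cond3 where "cond3 \<longleftrightarrow>
      (\<forall>d\<ge>0. \<exists>\<I>. open_F_cover G ?Y ?\<psi> F \<I> \<and> G_multiplicity_le G S X d \<I> (n + 1))"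
  note F_fam = F_famD[where F = F]

  have shrunk: thesis if c: cond1 and d: "0 \<le> d"
    and elim: "\<And>\<I>. open_F_cover G ?Y ?\<psi> F \<I> \<Longrightarrow> G_multiplicity_le G S X d \<I> (n + 1) \<Longrightarrow>
      (\<And>U g h x. U \<in> \<I> \<Longrightarrow> g \<in> carrier G \<Longrightarrow> (h, x) \<in> Y \<Longrightarrow> gball h d \<times> {x} \<inter> U \<noteq> {} \<Longrightarrow>
         gball h d \<times> {x} \<inter> translate g U \<noteq> {} \<Longrightarrow> translate g U = U) \<Longrightarrow> thesis" for d thesis
  proof -
    obtain \<U> where \<U>: "open_F_cover G ?Y ?\<psi> F \<U>" "G_Lebesgue_number G S X \<U> d"
        "\<And>y. y \<in> Y \<Longrightarrow> ecard {U \<in> \<U>. y \<in> U} \<le> enat (n + 1)"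
      using c d unfolding cond1_def eq_asdim_le_iff topspace_prod_space by blast
    show thesis
      by (rule shrunk_cover[OF d \<U>(1) \<U>(3) \<U>(2)], assumption) (rule elim)
  qed

  have 13: cond3 if c: cond1
    unfolding cond3_def
  proof (intro allI impI)
    fix d :: real assume "0 \<le> d"
    then obtain \<I> where "open_F_cover G ?Y ?\<psi> F \<I>" "G_multiplicity_le G S X d \<I> (n + 1)"
      by (rule shrunk[OF c])
    then show "\<exists>\<I>. open_F_cover G ?Y ?\<psi> F \<I> \<and> G_multiplicity_le G S X d \<I> (n + 1)"
      by blast
  qed

  have 12: cond2 if c: cond1
    unfolding cond2_def topspace_prod_space
  proof (intro allI impI)
    fix r :: real assume r: "0 < r"
    define d where "d = 2 * real (n + 1) * r"
    have "0 \<le> d"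
      using r by (simp add: d_def)
    then obtain \<I> where \<I>: "open_F_cover G ?Y ?\<psi> F \<I>" "G_multiplicity_le G S X d \<I> (n + 1)"
      and sep: "\<And>U g h x. U \<in> \<I> \<Longrightarrow> g \<in> carrier G \<Longrightarrow> (h, x) \<in> Y \<Longrightarrow> gball h d \<times> {x} \<inter> U \<noteq> {} \<Longrightarrow>
         gball h d \<times> {x} \<inter> translate g U \<noteq> {} \<Longrightarrow> translate g U = U"
      by (rule shrunk[OF c]) (rule that)
    have fam: "F_fam G Y ?\<psi> F \<I>"
      using \<I>(1) by (simp add: open_F_cover_iff)
    show "\<exists>\<J> :: nat \<Rightarrow> ('g \<times> 'x) set set.
        (\<forall>i\<le>n. F_fam G Y ?\<psi> F (\<J> i) \<and> G_disjoint G S r (\<J> i)) \<and> open_cover ?Y (\<Union>i\<le>n. \<J> i)"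
    proof (rule disjoint_families_from_multiplicity[OF assms(6,7) r d_def \<I>])
      fix \<sigma> h x assume \<sigma>: "\<sigma> \<noteq> {}" "\<sigma> \<subseteq> \<I>" and hx: "(h, x) \<in> Y"
        and meet: "\<And>U. U \<in> \<sigma> \<Longrightarrow> gball h d \<times> {x} \<inter> U \<noteq> {}"
      obtain U where U: "U \<in> \<sigma>"
        using \<sigma>(1) by blast
      then have UI: "U \<in> \<I>"
        using \<sigma>(2) by blast
      show "coll_stab \<sigma> \<in> F"
      proof (rule coll_stab_in_family[OF assms(5) _ U F_fam(3)[OF fam UI]])
        show "\<sigma> \<subseteq> Pow Y"
          using \<sigma>(2) F_fam(1)[OF fam] by blast
        show "translate g U = U" if "g \<in> carrier G" "translate g U \<in> \<sigma>" for g
          by (rule sep[OF UI that(1) hx meet[OF U] meet[OF that(2)]])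
      qed
    qed
  qed

  have 21: cond1 if c: cond2
    unfolding cond1_def eq_asdim_le_iff
  proof (intro allI impI)
    fix \<alpha> :: real assume \<alpha>: "0 \<le> \<alpha>"
    \<comment> \<open>the radius must be positive even for \<open>\<alpha> = 0\<close>\<close>
    have "0 < 2 * \<alpha> + 1"
      using \<alpha> by simp
    then obtain \<I> :: "nat \<Rightarrow> ('g \<times> 'x) set set" where
        \<I>: "\<And>i. i \<le> n \<Longrightarrow> F_fam G Y ?\<psi> F (\<I> i)" "open_cover ?Y (\<Union>i\<le>n. \<I> i)"
      and disj: "\<And>i. i \<le> n \<Longrightarrow> G_disjoint G S (2 * \<alpha> + 1) (\<I> i)"
      using c unfolding cond2_def topspace_prod_space by blast
    show "\<exists>\<U>. open_F_cover G ?Y ?\<psi> F \<U> \<and>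
        (\<forall>y\<in>topspace ?Y. ecard {U \<in> \<U>. y \<in> U} \<le> enat (n + 1)) \<and> G_Lebesgue_number G S X \<U> \<alpha>"
      by (rule cover_from_disjoint_families[OF \<alpha> _ \<I>(1) disj \<I>(2)]) auto
  qed

  have 32: cond2 if cond3 and vc: "virtually_closed G F"
    unfolding cond2_def topspace_prod_space
  proof (intro allI impI)
    fix r :: real assume r: "0 < r"
    define d where "d = 2 * real (n + 1) * r"
    have "0 \<le> d"
      using r by (simp add: d_def)
    then obtain \<I> where \<I>: "open_F_cover G ?Y ?\<psi> F \<I>" "G_multiplicity_le G S X d \<I> (n + 1)"
      using \<open>cond3\<close> unfolding cond3_def by blast
    have fam: "F_fam G Y ?\<psi> F \<I>"
      using \<I>(1) by (simp add: open_F_cover_iff)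
    show "\<exists>\<J> :: nat \<Rightarrow> ('g \<times> 'x) set set.
        (\<forall>i\<le>n. F_fam G Y ?\<psi> F (\<J> i) \<and> G_disjoint G S r (\<J> i)) \<and> open_cover ?Y (\<Union>i\<le>n. \<J> i)"
    proof (rule disjoint_families_from_multiplicity[OF assms(6,7) r d_def \<I>])
      fix \<sigma> :: "('g \<times> 'x) set set" assume \<sigma>: "finite \<sigma>" "\<sigma> \<noteq> {}" "\<sigma> \<subseteq> \<I>"
      obtain U where U: "U \<in> \<sigma>"
        using \<sigma>(2) by blast
      then have "U \<in> \<I>"
        using \<sigma>(3) by blast
      moreover have "\<sigma> \<subseteq> Pow Y"
        using \<sigma>(3) F_fam(1)[OF fam] by blast
      ultimately show "coll_stab \<sigma> \<in> F"
        by (intro coll_stab_in_virtually_closed_family[OF assms(5) vc _ \<sigma>(1) U] F_fam(3)[OF fam])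
    qed
  qed

  show ?thesis
    unfolding Let_def cond1_def[symmetric] cond2_def[symmetric] cond3_def[symmetric]
    using 12 13 21 32 by blast
qed

end
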